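(* Let $K$ be a local field of residue characteristic $p$ with $\mu_p(K)=\{1\}$, and let $\rho_K=\rho_{e,p}$ with $e=v_K(p)$. Then $\mathcal{J}_K=\mathrm{Jump}_{\rho_K}$.
   Context: A local field $K$ is a field with a non-archimedean absolute value for which it is a non-discrete locally compact space; $v_K$ is its normalized valuation ($v_K(p)=\infty$ if $\mathrm{char}(K)=p$), $m$ the maximal ideal of its ring of integers, $\mu_p(K)=\{\alpha\in K:\alpha^p=1\}$, $U_i(K)=1+m^i$. A character of $U_1(K)$ is a continuous group homomorphism $\chi:U_1(K)\to\mathbb{Q}_p/\mathbb{Z}_p$; its set of jumps is $J_\chi=\{i\in\mathbb{Z}_{\ge1}:\chi(U_i(K))\ne\chi(U_{i+1}(K))\}$. $\mathcal{J}_K$ is the set of all $J_\chi$, as $\chi$ runs over the characters of $U_1(K)$. A shift is a strictly increasing $\rho:\mathbb{Z}_{\ge1}\to\mathbb{Z}_{\ge1}$ with $\rho(1)>1$; $T_\rho=\mathbb{Z}_{\ge1}\setminus\rho(\mathbb{Z}_{\ge1})$. $\rho_{e,p}(i)=\min\{i+e,pi\}$ for $e\in\mathbb{Z}_{>0}\cup\{\infty\}$. $\mathrm{Jump}_\rho$ is the set of finite subsets $A\subseteq\mathbb{Z}_{\ge1}$ such that (i) if $a,b\in A$ and $a<b$ then $\rho(a)\le b$; (ii) $A\setminus\rho(A)\subseteq T_\rho$. *)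

theory Defs
  imports "HOL-Analysis.Analysis" "HOL-Algebra.Ideal_Product" "HOL-Algebra.QuotRing" "HOL-Library.Extended_Nat"
begin

section \<open>Local fields\<close>

text \<open>The field is a type, and \<open>av\<close> is its absolute value.\<close>

definition av_topology :: "('a::field \<Rightarrow> real) \<Rightarrow> 'a topology" where
  "av_topology av = Metric_space.mtopology UNIV (\<lambda>x y. av (x - y))"

locale local_field =
  fixes av :: "'a::field \<Rightarrow> real"
  assumes av_nonneg: "0 \<le> av x"
    and av_eq_0_iff: "av x = 0 \<longleftrightarrow> x = 0"
    and av_mult: "av (x * y) = av x * av y"
    and av_add_le_max: "av (x + y) \<le> max (av x) (av y)"
    and non_discrete: "av_topology av \<noteq> discrete_topology UNIV"
    and locally_compact: "locally_compact_space (av_topology av)"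

definition int_ring :: "('a::field \<Rightarrow> real) \<Rightarrow> 'a ring" where
  "int_ring av = \<lparr>carrier = {x. av x \<le> 1}, mult = (*), one = 1, zero = 0, add = (+)\<rparr>"

definition max_ideal :: "('a::field \<Rightarrow> real) \<Rightarrow> 'a set" where
  "max_ideal av = {x. av x < 1}"

definition has_residue_char :: "('a::field \<Rightarrow> real) \<Rightarrow> nat \<Rightarrow> bool" where
  "has_residue_char av p \<longleftrightarrow>
     (let k = int_ring av Quot max_ideal av
      in \<forall>n::nat. [n] \<cdot>\<^bsub>k\<^esub> \<one>\<^bsub>k\<^esub> = \<zero>\<^bsub>k\<^esub> \<longleftrightarrow> p dvd n)"

text \<open>The normalized valuation at nonzero elements: the absolute values of the nonzero elements of
  a local field are the integral powers of the largest absolute value below 1.\<close>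

definition normalized_val :: "('a::field \<Rightarrow> real) \<Rightarrow> 'a \<Rightarrow> int" where
  "normalized_val av x = (THE n. av x = (SUP y\<in>max_ideal av. av y) powi n)"

text \<open>The valuation of \<open>p\<close>, infinite if \<open>p = 0\<close> in the field. The truncation \<open>nat\<close> is harmless
  because the valuation of an integer is nonnegative.\<close>

definition ram_index :: "('a::field \<Rightarrow> real) \<Rightarrow> nat \<Rightarrow> enat" where
  "ram_index av p =
     (if (of_nat p :: 'a) = 0 then \<infinity> else enat (nat (normalized_val av (of_nat p))))"

definition mu :: "nat \<Rightarrow> 'a::field set" where
  "mu p = {\<alpha>. \<alpha> ^ p = 1}"

definition unit_filt :: "('a::field \<Rightarrow> real) \<Rightarrow> nat \<Rightarrow> 'a set" where
  "unit_filt av i = (+) 1 ` (max_ideal av [^]\<^bsub>ideals_set (int_ring av)\<^esub> i)"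

definition unit_group :: "('a::field \<Rightarrow> real) \<Rightarrow> nat \<Rightarrow> 'a monoid" where
  "unit_group av i = \<lparr>carrier = unit_filt av i, mult = (*), one = 1\<rparr>"


section \<open>The group of p-adic numbers modulo p-adic integers\<close>

text \<open>The additive group of the p-adic numbers is the completion of the rationals: Cauchy sequences
  modulo null sequences for the p-adic metric.\<close>

definition padic_val :: "nat \<Rightarrow> rat \<Rightarrow> int" where
  "padic_val p x =
     int (multiplicity (int p) (fst (quotient_of x))) -
     int (multiplicity (int p) (snd (quotient_of x)))"

definition padic_abs :: "nat \<Rightarrow> rat \<Rightarrow> real" where
  "padic_abs p x = (if x = 0 then 0 else real p powi (- padic_val p x))"

definition padic_dist :: "nat \<Rightarrow> rat \<Rightarrow> rat \<Rightarrow> real" where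
  "padic_dist p x y = padic_abs p (x - y)"

definition padic_cauchy :: "nat \<Rightarrow> (nat \<Rightarrow> rat) monoid" where
  "padic_cauchy p =
     \<lparr>carrier = {\<sigma>. Metric_space.MCauchy UNIV (padic_dist p) \<sigma>},
      mult = (\<lambda>\<sigma> \<tau> n. \<sigma> n + \<tau> n), one = (\<lambda>n. 0)\<rparr>"

definition padic_null :: "nat \<Rightarrow> (nat \<Rightarrow> rat) set" where
  "padic_null p =
     {\<sigma>. limitin (Metric_space.mtopology UNIV (padic_dist p)) \<sigma> 0 sequentially}"

definition Qp :: "nat \<Rightarrow> (nat \<Rightarrow> rat) set monoid" where
  "Qp p = padic_cauchy p Mod padic_null p"

text \<open>The p-adic absolute value of the class of a Cauchy sequence is the limit of the absolute
  values of the terms; the p-adic integers are its closed unit ball.\<close>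

definition Zp :: "nat \<Rightarrow> (nat \<Rightarrow> rat) set set" where
  "Zp p = {X \<in> carrier (Qp p). \<forall>\<sigma>\<in>X. lim (\<lambda>n. padic_abs p (\<sigma> n)) \<le> 1}"

definition Qp_mod_Zp :: "nat \<Rightarrow> (nat \<Rightarrow> rat) set set monoid" where
  "Qp_mod_Zp p = Qp p Mod Zp p"


section \<open>Characters and their jumps\<close>

text \<open>The p-adic integers are open in the p-adic numbers, so the quotient topology is discrete.\<close>

definition characters :: "('a::field \<Rightarrow> real) \<Rightarrow> nat \<Rightarrow> ('a \<Rightarrow> (nat \<Rightarrow> rat) set set) set" where
  "characters av p =
     {\<psi> \<in> hom (unit_group av 1) (Qp_mod_Zp p).
        continuous_map (subtopology (av_topology av) (unit_filt av 1))
          (discrete_topology (carrier (Qp_mod_Zp p))) \<psi>}"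

definition jumps :: "('a::field \<Rightarrow> real) \<Rightarrow> ('a \<Rightarrow> 'b) \<Rightarrow> nat set" where
  "jumps av \<psi> = {i. 1 \<le> i \<and> \<psi> ` unit_filt av i \<noteq> \<psi> ` unit_filt av (i + 1)}"

definition jump_sets :: "('a::field \<Rightarrow> real) \<Rightarrow> nat \<Rightarrow> nat set set" where
  "jump_sets av p = jumps av ` characters av p"


section \<open>Shifts and jump sets\<close>

text \<open>Shifts are functions on the positive integers; their value at 0 is irrelevant.\<close>

definition T_set :: "(nat \<Rightarrow> nat) \<Rightarrow> nat set" where
  "T_set \<rho> = {1..} - \<rho> ` {1..}"

definition rho :: "enat \<Rightarrow> nat \<Rightarrow> nat \<Rightarrow> nat" where
  "rho e p i = the_enat (min (enat i + e) (enat (p * i)))"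

definition Jump :: "(nat \<Rightarrow> nat) \<Rightarrow> nat set set" where
  "Jump \<rho> =
     {A. finite A \<and> A \<subseteq> {1..} \<and>
         (\<forall>a\<in>A. \<forall>b\<in>A. a < b \<longrightarrow> \<rho> a \<le> b) \<and>
         A - \<rho> ` A \<subseteq> T_set \<rho>}"

end

theory Submission
  imports Defs "HOL-Number_Theory.Number_Theory"
begin

text \<open>
  Both inclusions rest on one fact about \<open>p\<close>-th powers: raising to the \<open>p\<close>-th power maps \<open>U i\<close> into
  \<open>U (\<rho> i)\<close> and induces a bijection from \<open>U i / U (i + 1)\<close> to \<open>U (\<rho> i) / U (\<rho> i + 1)\<close>
  (lemmas \<open>unit_filt_power\<close>, \<open>unit_filt_power_injective\<close>, \<open>unit_filt_power_surjective\<close>). For \<open>1 + x\<close>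
  the power is governed by the larger of \<open>x ^ p\<close> and \<open>p * x\<close>. When the two have the same size, an
  element of the kernel would, by successive approximation and compactness, produce a nontrivial
  \<open>p\<close>-th root of unity. Surjectivity then follows by counting, all graded pieces being copies of
  the finite residue field.

  The subgroups of \<open>\<rat>\<^sub>p / \<int>\<^sub>p\<close> form a chain, in which passing to the next smaller one is
  multiplication by \<open>p\<close>. Let \<open>H i\<close> be the image of \<open>U i\<close> under a character. At a jump \<open>i\<close>,
  \<open>H (i + 1) = p * H i\<close>, and this lies in \<open>H (\<rho> i)\<close>; so there is no further jump below \<open>\<rho> i\<close>.
  Moreover \<open>H (\<rho> i)\<close> is generated by \<open>p * H i\<close> and \<open>H (\<rho> i + 1)\<close>, so a jump at \<open>\<rho> i\<close> requires one
  at \<open>i\<close>. This is \<open>val_jumps_in_Jump\<close>.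

  Conversely let \<open>A\<close> be a jump set and let \<open>c i\<close> count its elements from \<open>i\<close> on. A character has
  jump set \<open>A\<close> as soon as the image of \<open>U i\<close> is the subgroup of order \<open>p ^ c i\<close>. Such a
  character is extended step by step from \<open>U (i + 1)\<close> to \<open>U i\<close>. Writing \<open>i = \<rho> (\<dots> (\<rho> j))\<close> with \<open>k\<close>
  factors \<open>\<rho>\<close> and \<open>j\<close> outside the range of \<open>\<rho>\<close>, the group \<open>U i\<close> is generated over \<open>U (i + 1)\<close>
  by \<open>p ^ k\<close>-th powers of elements of \<open>U j\<close>; these receive values of order at most \<open>p ^ (c j - k)\<close>, and
  one of them a value of exactly that order if \<open>j\<close> is in \<open>A\<close>. The induction works because the
  condition imposed (definition \<open>adapted\<close>) concerns \<open>p ^ n\<close>-th powers of elements of all levels,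
  including those on which the character is not yet defined. The result is \<open>Jump_realised\<close>.

  Elements of \<open>\<rat>\<^sub>p / \<int>\<^sub>p\<close> are represented by rationals throughout, a subgroup being described by a
  bound on the \<open>p\<close>-adic absolute value.
\<close>


section \<open>The p-adic absolute value on the rationals\<close>

lemma padic_val_divide:
  fixes a b :: int
  assumes "prime p" "a \<noteq> 0" "b \<noteq> 0"
  shows "padic_val p (of_int a / of_int b) = int (multiplicity (int p) a) - int (multiplicity (int p) b)"
proof -
  obtain n d where nd: "quotient_of (of_int a / of_int b) = (n, d)" by force
  have d: "d > 0" using quotient_of_denom_pos[OF nd] .
  have "of_int a / of_int b = (of_int n / of_int d :: rat)" using quotient_of_div[OF nd] .
  then have "(of_int (a * d) :: rat) = of_int (n * b)"
    using d assms by (simp add: field_simps)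
  then have eq: "a * d = n * b" by (metis of_int_eq_iff)
  have n: "n \<noteq> 0" using eq assms d by auto
  have pp: "prime_elem (int p)" using assms(1) by simp
  have "multiplicity (int p) a + multiplicity (int p) d = multiplicity (int p) n + multiplicity (int p) b"
    using prime_elem_multiplicity_mult_distrib[OF pp] eq n d assms by (metis less_irrefl)
  then show ?thesis unfolding padic_val_def nd by simp
qed

lemma rat_as_quotient:
  fixes x :: rat
  obtains a b :: int where "x = of_int a / of_int b" "b \<noteq> 0"
  by (metis less_irrefl prod.collapse quotient_of_denom_pos quotient_of_div)

lemma padic_abs_0 [simp]: "padic_abs p 0 = 0"
  by (simp add: padic_abs_def)

lemma padic_abs_nonneg: "0 \<le> padic_abs p x"
  by (simp add: padic_abs_def)

lemma padic_abs_eq_0_iff: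
  assumes "prime p"
  shows "padic_abs p x = 0 \<longleftrightarrow> x = 0"
  using assms prime_gt_0_nat[OF assms] by (simp add: padic_abs_def power_int_eq_0_iff)

lemma padic_abs_mult:
  assumes p: "prime p"
  shows "padic_abs p (x * y) = padic_abs p x * padic_abs p y"
proof (cases "x = 0 \<or> y = 0")
  case False
  obtain a b :: int where x: "x = of_int a / of_int b" "b \<noteq> 0" by (rule rat_as_quotient)
  obtain c d :: int where y: "y = of_int c / of_int d" "d \<noteq> 0" by (rule rat_as_quotient)
  have nz: "a \<noteq> 0" "c \<noteq> 0" using False x y by auto
  have xy: "x * y = of_int (a * c) / of_int (b * d)" using x y by simp
  have pp: "prime_elem (int p)" using p by simp
  have "padic_val p (x * y) = padic_val p x + padic_val p y"
    unfolding xy padic_val_divide[OF p, of "a * c" "b * d"]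
    using padic_val_divide[OF p nz(1) x(2)] padic_val_divide[OF p nz(2) y(2)] nz x y
      padic_val_divide[OF p, of "a * c" "b * d"]
    by (simp add: prime_elem_multiplicity_mult_distrib[OF pp])
  then show ?thesis
    using False prime_gt_0_nat[OF p] by (simp add: padic_abs_def power_int_diff power_int_minus divide_inverse)
qed auto

lemma padic_abs_of_int:
  assumes p: "prime p" and "a \<noteq> 0"
  shows "padic_abs p (of_int a) = 1 / real p ^ multiplicity (int p) a"
proof -
  have "padic_val p (of_int a) = int (multiplicity (int p) a)"
    using padic_val_divide[OF p assms(2), of 1] by simp
  then show ?thesis using assms by (simp add: padic_abs_def power_int_minus divide_inverse)
qed

lemma padic_abs_of_int_le_iff:
  assumes p: "prime p"
  shows "padic_abs p (of_int a) \<le> 1 / real p ^ r \<longleftrightarrow> int p ^ r dvd a"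
proof (cases "a = 0")
  case False
  have "\<not> is_unit (int p)" using p by auto
  then have "int p ^ r dvd a \<longleftrightarrow> r \<le> multiplicity (int p) a"
    using False by (simp add: power_dvd_iff_le_multiplicity)
  moreover have "1 / real p ^ multiplicity (int p) a \<le> 1 / real p ^ r \<longleftrightarrow> r \<le> multiplicity (int p) a"
    using prime_gt_1_nat[OF p] by (simp add: field_simps)
  ultimately show ?thesis using False by (simp add: padic_abs_of_int[OF p])
qed auto

lemma padic_abs_of_int_le_1:
  assumes "prime p"
  shows "padic_abs p (of_int a) \<le> 1"
  using padic_abs_of_int_le_iff[OF assms, of a 0] by simp

lemma padic_abs_1:
  assumes "prime p"
  shows "padic_abs p 1 = 1"
  using padic_abs_of_int[OF assms, of 1] by simp

lemma padic_abs_minus: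
  assumes "prime p"
  shows "padic_abs p (- x) = padic_abs p x"
proof -
  have "multiplicity (int p) (-1) = 0"
    using assms by (intro not_dvd_imp_multiplicity_0) auto
  then have "padic_abs p (-1) = 1" using padic_abs_of_int[OF assms, of "-1"] by simp
  then show ?thesis using padic_abs_mult[OF assms, of "-1" x] by simp
qed

lemma padic_abs_minus_commute:
  assumes "prime p"
  shows "padic_abs p (x - y) = padic_abs p (y - x)"
  using padic_abs_minus[OF assms, of "x - y"] by simp

lemma padic_abs_p:
  assumes "prime p"
  shows "padic_abs p (of_nat p) = 1 / real p"
proof -
  have "padic_abs p (of_int (int p)) = 1 / real p ^ multiplicity (int p) (int p)"
    using prime_gt_0_nat[OF assms] by (intro padic_abs_of_int[OF assms]) auto
  moreover have "multiplicity (int p) (int p) = 1"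
    using assms by (intro multiplicity_self) auto
  ultimately show ?thesis by simp
qed

lemma padic_abs_divide_p:
  assumes "prime p"
  shows "padic_abs p (x / of_nat p) = real p * padic_abs p x"
proof -
  have "padic_abs p (x / of_nat p * of_nat p) = padic_abs p (x / of_nat p) * (1 / real p)"
    by (simp only: padic_abs_mult[OF assms] padic_abs_p[OF assms])
  then show ?thesis using prime_gt_0_nat[OF assms] by (simp add: field_simps)
qed

text \<open>The closed unit ball consists of the fractions whose reduced denominator is prime to \<open>p\<close>.\<close>

lemma padic_abs_le_1_fraction:
  assumes p: "prime p" and z: "padic_abs p z \<le> 1"
  obtains a b :: int where "z = of_int a / of_int b" "b > 0" "\<not> int p dvd b" "padic_abs p (of_int b) = 1"
proof -
  obtain a b where q: "quotient_of z = (a, b)" by force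
  have b: "b > 0" "coprime a b" "z = of_int a / of_int b"
    using quotient_of_denom_pos[OF q] quotient_of_coprime[OF q] quotient_of_div[OF q] by auto
  have pb: "\<not> int p dvd b"
  proof
    assume pb: "int p dvd b"
    then have pa: "\<not> int p dvd a" using b(2) p
      by (metis coprime_common_divisor not_prime_unit prime_int_nat_transfer of_nat_0_le_iff nat_int)
    have "of_int a = z * of_int b" using b by simp
    then have "padic_abs p (of_int a) = padic_abs p z * padic_abs p (of_int b)"
      by (simp add: padic_abs_mult[OF p])
    also have "\<dots> \<le> 1 * padic_abs p (of_int b)"
      using z padic_abs_nonneg by (intro mult_right_mono) auto
    also have "\<dots> \<le> 1 / real p ^ 1" using padic_abs_of_int_le_iff[OF p, of b 1] pb by simp
    finally show False using padic_abs_of_int_le_iff[OF p, of a 1] pa by simp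
  qed
  moreover have "padic_abs p (of_int b) = 1"
    using padic_abs_of_int[OF p, of b] b pb by (simp add: not_dvd_imp_multiplicity_0)
  ultimately show thesis using that b by blast
qed

text \<open>The nonzero absolute values are powers of \<open>p\<close>, hence at least a factor \<open>p\<close> apart.\<close>

lemma padic_abs_less_imp:
  assumes p: "prime p" and less: "padic_abs p x < padic_abs p y"
  shows "real p * padic_abs p x \<le> padic_abs p y"
proof (cases "x = 0")
  case True
  then show ?thesis by (simp add: padic_abs_nonneg)
next
  case False
  have y: "y \<noteq> 0" using less padic_abs_nonneg[of p x] by auto
  have p1: "1 < real p" using prime_gt_1_nat[OF p] by simp
  have "- padic_val p x < - padic_val p y"
  proof (rule ccontr)
    assume "\<not> ?thesis"
    then have "real p powi (- padic_val p y) \<le> real p powi (- padic_val p x)"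
      using p1 by (intro power_int_increasing) auto
    then show False using less False y by (simp add: padic_abs_def)
  qed
  then have "real p powi (1 + - padic_val p x) \<le> real p powi (- padic_val p y)"
    using p1 by (intro power_int_increasing) auto
  moreover have "real p powi (1 + - padic_val p x) = real p * padic_abs p x"
    using False p1 by (subst power_int_add) (auto simp: padic_abs_def)
  ultimately show ?thesis using y by (simp add: padic_abs_def)
qed

lemma padic_abs_add:
  assumes p: "prime p"
  shows "padic_abs p (x + y) \<le> max (padic_abs p x) (padic_abs p y)"
proof -
  have wlog: "padic_abs p (x + y) \<le> padic_abs p y" 
    if le: "padic_abs p x \<le> padic_abs p y" and y: "y \<noteq> 0" for x y
  proof -
    \<comment> \<open>after division by \<open>y\<close>: a rational of absolute value at most 1 stays so when 1 is added\<close>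
    have one: "padic_abs p (1 + z) \<le> 1" if z: "padic_abs p z \<le> 1" for z
    proof -
      obtain a b where b: "z = of_int a / of_int b" "b > 0" "padic_abs p (of_int b) = 1"
        using padic_abs_le_1_fraction[OF p z] by metis
      have "(1 + z) * of_int b = of_int (a + b)" using b by (simp add: field_simps)
      then show ?thesis
        using padic_abs_mult[OF p, of "1 + z" "of_int b"] b(3) padic_abs_of_int_le_1[OF p, of "a + b"] by simp
    qed
    have "padic_abs p (x / y) * padic_abs p y = padic_abs p x"
      using padic_abs_mult[OF p, of "x / y" y] y by simp
    then have "padic_abs p (x / y) \<le> 1"
      using le y padic_abs_eq_0_iff[OF p, of y] padic_abs_nonneg[of p y]
      by (smt (verit) mult_less_cancel_right1)
    then have "padic_abs p (1 + x / y) \<le> 1" by (rule one)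
    then have "padic_abs p (1 + x / y) * padic_abs p y \<le> padic_abs p y"
      using padic_abs_nonneg[of p y] by (simp add: mult_left_le_one_le padic_abs_nonneg)
    moreover have "(1 + x / y) * y = x + y" using y by (simp add: field_simps)
    ultimately show ?thesis using padic_abs_mult[OF p, of "1 + x / y" y] by simp
  qed
  show ?thesis
  proof (cases "x = 0 \<or> y = 0")
    case True then show ?thesis by (auto simp: padic_abs_nonneg)
  next
    case False
    then show ?thesis
      using wlog[of x y] wlog[of y x] by (cases "padic_abs p x \<le> padic_abs p y") (auto simp: add.commute max_def)
  qed
qed

lemma padic_abs_diff:
  assumes "prime p"
  shows "padic_abs p (x - y) \<le> max (padic_abs p x) (padic_abs p y)"
  using padic_abs_add[OF assms, of x "- y"] padic_abs_minus[OF assms] by simp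

text \<open>Rationals without \<open>p\<close> in the denominator are limits of integers, since a denominator
  prime to \<open>p\<close> has an inverse modulo \<open>p ^ r\<close>.\<close>

lemma padic_abs_approx_int:
  assumes p: "prime p" and z: "padic_abs p z \<le> 1"
  obtains n :: int where "padic_abs p (z - of_int n) \<le> 1 / real p ^ r"
proof -
  obtain a b where b: "z = of_int a / of_int b" "b > 0" "\<not> int p dvd b"
      and b1: "padic_abs p (of_int b) = 1"
    using padic_abs_le_1_fraction[OF p z] by metis
  have "coprime b (int p ^ r)"
    using p b(3) by (metis coprime_commute coprime_power_left_iff prime_imp_coprime prime_int_nat_transfer
        nat_int of_nat_0_le_iff)
  then obtain c where c: "[b * c = 1] (mod int p ^ r)" using cong_solve_coprime_int by blast
  have "int p ^ r dvd a * (1 - b * c)"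
    using c by (simp add: cong_iff_dvd_diff dvd_diff_commute)
  then have "padic_abs p (of_int (a * (1 - b * c))) \<le> 1 / real p ^ r"
    using padic_abs_of_int_le_iff[OF p] by blast
  moreover have "(z - of_int (a * c)) * of_int b = of_int (a * (1 - b * c))"
    using b by (simp add: field_simps)
  ultimately have "padic_abs p (z - of_int (a * c)) \<le> 1 / real p ^ r"
    using padic_abs_mult[OF p, of "z - of_int (a * c)" "of_int b"] b1 by simp
  then show thesis by (rule that)
qed

text \<open>A subgroup of the rationals that contains all rationals without \<open>p\<close> in the denominator is
  determined by the absolute values that occur in it, because integer multiples of an element
  approximate every rational of at most its absolute value. Thus these subgroups form a chain, as
  do the subgroups of \<open>\<rat>\<^sub>p / \<int>\<^sub>p\<close>.\<close>

lemma padic_subgroup_closed_downward: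
  fixes S :: "rat set"
  assumes p: "prime p"
    and S: "\<And>x. padic_abs p x \<le> 1 \<Longrightarrow> x \<in> S" "\<And>x y. x \<in> S \<Longrightarrow> y \<in> S \<Longrightarrow> x + y \<in> S"
      "\<And>x. x \<in> S \<Longrightarrow> - x \<in> S"
    and x: "x \<in> S" and y: "padic_abs p y \<le> padic_abs p x"
  shows "y \<in> S"
proof (cases "x = 0")
  case True
  then show ?thesis using S(1) y padic_abs_nonneg[of p y] by auto
next
  case False
  have nat_mult: "of_nat n * x \<in> S" for n
  proof (induction n)
    case 0 then show ?case using S(1)[of 0] by simp
  next
    case (Suc n) then show ?case using S(2)[OF x Suc] by (simp add: algebra_simps)
  qed
  have int_mult: "of_int n * x \<in> S" for n
  proof (cases "n \<ge> 0")
    case True then show ?thesis using nat_mult[of "nat n"] by simp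
  next
    case False then show ?thesis using S(3)[OF nat_mult[of "nat (- n)"]] by simp
  qed
  have x0: "padic_abs p x > 0" using False padic_abs_eq_0_iff[OF p] padic_abs_nonneg[of p x]
    by (metis less_eq_real_def)
  have "padic_abs p (y / x) * padic_abs p x = padic_abs p y"
    using padic_abs_mult[OF p, of "y / x" x] False by simp
  then have le: "padic_abs p (y / x) \<le> 1" using y x0 by (smt (verit) mult_less_cancel_right1)
  obtain r where r: "padic_abs p x < real p ^ r"
    using real_arch_pow prime_gt_1_nat[OF p] by (metis of_nat_1 of_nat_less_iff)
  obtain n where n: "padic_abs p (y / x - of_int n) \<le> 1 / real p ^ r"
    using padic_abs_approx_int[OF p le] by blast
  have "padic_abs p ((y / x - of_int n) * x) \<le> 1 / real p ^ r * real p ^ r"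
    unfolding padic_abs_mult[OF p] using n r padic_abs_nonneg by (intro mult_mono) auto
  also have "\<dots> = 1" using prime_gt_0_nat[OF p] by simp
  finally have "(y / x - of_int n) * x \<in> S" by (rule S(1))
  then have "(y / x - of_int n) * x + of_int n * x \<in> S" using int_mult S(2) by blast
  then show ?thesis using False by (simp add: field_simps)
qed

section \<open>The quotient of the p-adic numbers by the p-adic integers\<close>

context
  fixes p :: nat
  assumes p: "prime p"
begin

lemma padic_metric: "Metric_space UNIV (padic_dist p)"
proof
  fix x y z :: rat
  show "0 \<le> padic_dist p x y" by (simp add: padic_dist_def padic_abs_nonneg)
  show "padic_dist p x y = padic_dist p y x"
    by (simp add: padic_dist_def padic_abs_minus_commute[OF p])
  show "padic_dist p x y = 0 \<longleftrightarrow> x = y" by (simp add: padic_dist_def padic_abs_eq_0_iff[OF p])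
  have "padic_abs p (x - z) \<le> max (padic_abs p (x - y)) (padic_abs p (y - z))"
    using padic_abs_add[OF p, of "x - y" "y - z"] by simp
  then show "padic_dist p x z \<le> padic_dist p x y + padic_dist p y z"
    using padic_abs_nonneg[of p "x - y"] padic_abs_nonneg[of p "y - z"] by (simp add: padic_dist_def)
qed

lemma padic_cauchy_iff:
  "\<sigma> \<in> carrier (padic_cauchy p) \<longleftrightarrow>
     (\<forall>\<epsilon>>0. \<exists>N. \<forall>n n'. N \<le> n \<longrightarrow> N \<le> n' \<longrightarrow> padic_abs p (\<sigma> n - \<sigma> n') < \<epsilon>)"
  by (simp add: padic_cauchy_def Metric_space.MCauchy_def[OF padic_metric] padic_dist_def)

lemma padic_null_iff:
  "\<sigma> \<in> padic_null p \<longleftrightarrow> (\<forall>\<epsilon>>0. \<exists>N. \<forall>n\<ge>N. padic_abs p (\<sigma> n) < \<epsilon>)"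
  by (simp add: padic_null_def Metric_space.limit_metric_sequentially[OF padic_metric] padic_dist_def)

lemma padic_cauchy_const: "(\<lambda>n. q) \<in> carrier (padic_cauchy p)"
  by (simp add: padic_cauchy_iff)

lemma padic_cauchy_add:
  assumes "\<sigma> \<in> carrier (padic_cauchy p)" "\<tau> \<in> carrier (padic_cauchy p)"
  shows "(\<lambda>n. \<sigma> n + \<tau> n) \<in> carrier (padic_cauchy p)"
  unfolding padic_cauchy_iff
proof (intro allI impI)
  fix e :: real assume "e > 0"
  obtain N where N: "\<And>n n'. N \<le> n \<Longrightarrow> N \<le> n' \<Longrightarrow> padic_abs p (\<sigma> n - \<sigma> n') < e"
    using assms(1) \<open>e > 0\<close> unfolding padic_cauchy_iff by blast
  obtain N' where N': "\<And>n n'. N' \<le> n \<Longrightarrow> N' \<le> n' \<Longrightarrow> padic_abs p (\<tau> n - \<tau> n') < e"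
    using assms(2) \<open>e > 0\<close> unfolding padic_cauchy_iff by blast
  have "padic_abs p (\<sigma> n + \<tau> n - (\<sigma> n' + \<tau> n')) < e" if "max N N' \<le> n" "max N N' \<le> n'" for n n'
    using padic_abs_add[OF p, of "\<sigma> n - \<sigma> n'" "\<tau> n - \<tau> n'"] N[of n n'] N'[of n n'] that
    by (simp add: algebra_simps)
  then show "\<exists>N. \<forall>n n'. N \<le> n \<longrightarrow> N \<le> n' \<longrightarrow> padic_abs p (\<sigma> n + \<tau> n - (\<sigma> n' + \<tau> n')) < e"
    by blast
qed

lemma padic_cauchy_minus:
  assumes "\<sigma> \<in> carrier (padic_cauchy p)"
  shows "(\<lambda>n. - \<sigma> n) \<in> carrier (padic_cauchy p)"
proof -
  have "padic_abs p (- \<sigma> n - - \<sigma> n') = padic_abs p (\<sigma> n - \<sigma> n')" for n n'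
    using padic_abs_minus[OF p, of "\<sigma> n - \<sigma> n'"] by simp
  then show ?thesis using assms by (simp add: padic_cauchy_iff)
qed

lemma padic_cauchy_group: "comm_group (padic_cauchy p)"
proof (rule comm_groupI)
  fix x assume x: "x \<in> carrier (padic_cauchy p)"
  show "\<exists>y\<in>carrier (padic_cauchy p). y \<otimes>\<^bsub>padic_cauchy p\<^esub> x = \<one>\<^bsub>padic_cauchy p\<^esub>"
    using padic_cauchy_minus[OF x] by (intro bexI[of _ "\<lambda>n. - x n"]) (auto simp: padic_cauchy_def)
qed (use padic_cauchy_add padic_cauchy_const in \<open>auto simp: padic_cauchy_def algebra_simps\<close>)

lemma padic_cauchy_simps [simp]:
  "\<sigma> \<otimes>\<^bsub>padic_cauchy p\<^esub> \<tau> = (\<lambda>n. \<sigma> n + \<tau> n)" "\<one>\<^bsub>padic_cauchy p\<^esub> = (\<lambda>n. 0)"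
  by (auto simp: padic_cauchy_def)

lemma padic_null_subset: "padic_null p \<subseteq> carrier (padic_cauchy p)"
proof
  fix \<sigma> assume s: "\<sigma> \<in> padic_null p"
  show "\<sigma> \<in> carrier (padic_cauchy p)"
    unfolding padic_cauchy_iff
  proof (intro allI impI)
    fix e :: real assume "e > 0"
    then obtain N where N: "\<And>n. N \<le> n \<Longrightarrow> padic_abs p (\<sigma> n) < e"
      using s unfolding padic_null_iff by blast
    have "padic_abs p (\<sigma> n - \<sigma> n') < e" if "N \<le> n" "N \<le> n'" for n n'
      using padic_abs_diff[OF p, of "\<sigma> n" "\<sigma> n'"] N[of n] N[of n'] that by simp
    then show "\<exists>N. \<forall>n n'. N \<le> n \<longrightarrow> N \<le> n' \<longrightarrow> padic_abs p (\<sigma> n - \<sigma> n') < e" by blast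
  qed
qed

lemma padic_null_subgroup: "subgroup (padic_null p) (padic_cauchy p)"
proof (rule group.subgroupI)
  show "group (padic_cauchy p)" using padic_cauchy_group by (simp add: comm_group_def)
  show "padic_null p \<subseteq> carrier (padic_cauchy p)" by (rule padic_null_subset)
  have "(\<lambda>n. 0) \<in> padic_null p" by (simp add: padic_null_iff)
  then show "padic_null p \<noteq> {}" by blast
next
  fix \<sigma> assume s: "\<sigma> \<in> padic_null p"
  have "(\<lambda>n. - \<sigma> n) \<in> carrier (padic_cauchy p)" "\<sigma> \<in> carrier (padic_cauchy p)"
    using s padic_null_subset padic_cauchy_minus by blast+
  then have "inv\<^bsub>padic_cauchy p\<^esub> \<sigma> = (\<lambda>n. - \<sigma> n)"
    using padic_cauchy_group
    by (intro group.inv_equality) (auto simp: comm_group_def)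
  then show "inv\<^bsub>padic_cauchy p\<^esub> \<sigma> \<in> padic_null p"
    using s by (simp add: padic_null_iff padic_abs_minus[OF p])
next
  fix \<sigma> \<tau> assume s: "\<sigma> \<in> padic_null p" "\<tau> \<in> padic_null p"
  have "\<exists>N. \<forall>n\<ge>N. padic_abs p (\<sigma> n + \<tau> n) < e" if "e > 0" for e
  proof -
    obtain N where N: "\<And>n. N \<le> n \<Longrightarrow> padic_abs p (\<sigma> n) < e"
      using s(1) \<open>e > 0\<close> unfolding padic_null_iff by blast
    obtain N' where N': "\<And>n. N' \<le> n \<Longrightarrow> padic_abs p (\<tau> n) < e"
      using s(2) \<open>e > 0\<close> unfolding padic_null_iff by blast
    have "padic_abs p (\<sigma> n + \<tau> n) < e" if "max N N' \<le> n" for n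
      using padic_abs_add[OF p, of "\<sigma> n" "\<tau> n"] N[of n] N'[of n] that by simp
    then show ?thesis by blast
  qed
  then show "\<sigma> \<otimes>\<^bsub>padic_cauchy p\<^esub> \<tau> \<in> padic_null p" by (simp add: padic_null_iff)
qed

lemma padic_null_normal: "padic_null p \<lhd> padic_cauchy p"
  by (rule comm_group.subgroup_imp_normal[OF padic_cauchy_group padic_null_subgroup])

lemma Qp_group: "comm_group (Qp p)"
  unfolding Qp_def by (rule comm_group.abelian_FactGroup[OF padic_cauchy_group padic_null_subgroup])

text \<open>The absolute values of the terms of a Cauchy sequence converge by the reverse triangle
  inequality; their limit exceeds 1 unless almost all terms lie in the closed unit ball.\<close>

lemma padic_cauchy_abs_convergent:
  assumes "\<sigma> \<in> carrier (padic_cauchy p)"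
  shows "convergent (\<lambda>n. padic_abs p (\<sigma> n))"
proof -
  have tri: "\<bar>padic_abs p x - padic_abs p y\<bar> \<le> padic_abs p (x - y)" for x y
    using padic_abs_add[OF p, of "x - y" y] padic_abs_add[OF p, of "y - x" x]
      padic_abs_minus_commute[OF p, of x y] padic_abs_nonneg[of p x] padic_abs_nonneg[of p y]
      padic_abs_nonneg[of p "x - y"]
    by (simp split: if_splits add: max_def)
  have "Cauchy (\<lambda>n. padic_abs p (\<sigma> n))"
    unfolding Cauchy_def dist_real_def
  proof (intro allI impI)
    fix e :: real assume "e > 0"
    then obtain N where "\<And>n n'. N \<le> n \<Longrightarrow> N \<le> n' \<Longrightarrow> padic_abs p (\<sigma> n - \<sigma> n') < e"
      using assms unfolding padic_cauchy_iff by blast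
    then show "\<exists>M. \<forall>m\<ge>M. \<forall>n\<ge>M. \<bar>padic_abs p (\<sigma> m) - padic_abs p (\<sigma> n)\<bar> < e"
      using tri by (meson le_less_trans)
  qed
  then show ?thesis by (rule Cauchy_convergent)
qed

lemma padic_lim_le_1_iff:
  assumes s: "\<sigma> \<in> carrier (padic_cauchy p)"
  shows "lim (\<lambda>n. padic_abs p (\<sigma> n)) \<le> 1 \<longleftrightarrow> (\<exists>N. \<forall>n\<ge>N. padic_abs p (\<sigma> n) \<le> 1)"
proof
  assume "\<exists>N. \<forall>n\<ge>N. padic_abs p (\<sigma> n) \<le> 1"
  then show "lim (\<lambda>n. padic_abs p (\<sigma> n)) \<le> 1"
    using padic_cauchy_abs_convergent[OF s] by (metis LIMSEQ_le_const2 convergent_LIMSEQ_iff)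
next
  assume le: "lim (\<lambda>n. padic_abs p (\<sigma> n)) \<le> 1"
  have "(\<lambda>n. padic_abs p (\<sigma> n)) \<longlonglongrightarrow> lim (\<lambda>n. padic_abs p (\<sigma> n))"
    using padic_cauchy_abs_convergent[OF s] by (simp add: convergent_LIMSEQ_iff)
  then have "\<forall>\<^sub>F n in sequentially. padic_abs p (\<sigma> n) < 2"
    using le by (intro order_tendstoD(2)) auto
  then obtain N where N: "\<And>n. n \<ge> N \<Longrightarrow> padic_abs p (\<sigma> n) < 2"
    unfolding eventually_sequentially by blast
  \<comment> \<open>there is no absolute value strictly between 1 and \<open>p\<close>\<close>
  have "padic_abs p (\<sigma> n) \<le> 1" if "n \<ge> N" for n
  proof (rule ccontr)
    assume gt: "\<not> padic_abs p (\<sigma> n) \<le> 1"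
    then have "\<sigma> n \<noteq> 0" by auto
    then have eq: "padic_abs p (\<sigma> n) = real p powi (- padic_val p (\<sigma> n))" by (simp add: padic_abs_def)
    have p1: "real p > 1" using prime_gt_1_nat[OF p] by simp
    have "- padic_val p (\<sigma> n) \<ge> 1"
    proof (rule ccontr)
      assume "\<not> ?thesis"
      then have "real p powi (- padic_val p (\<sigma> n)) \<le> real p powi 0"
        using p1 by (intro power_int_increasing) auto
      then show False using eq gt by simp
    qed
    then have "real p powi 1 \<le> real p powi (- padic_val p (\<sigma> n))"
      using p1 by (intro power_int_increasing) auto
    then show False using eq N[OF that] prime_ge_2_nat[OF p] by simp
  qed
  then show "\<exists>N. \<forall>n\<ge>N. padic_abs p (\<sigma> n) \<le> 1" by blast
qed

definition padic_class :: "(nat \<Rightarrow> rat) \<Rightarrow> (nat \<Rightarrow> rat) set" where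
  "padic_class \<sigma> = padic_null p #>\<^bsub>padic_cauchy p\<^esub> \<sigma>"

lemma padic_class_hom: "padic_class \<in> hom (padic_cauchy p) (Qp p)"
  using normal.r_coset_hom_Mod[OF padic_null_normal] by (simp add: Qp_def padic_class_def[abs_def])

lemma padic_class_surj:
  assumes "X \<in> carrier (Qp p)"
  obtains \<sigma> where "\<sigma> \<in> carrier (padic_cauchy p)" "X = padic_class \<sigma>"
  using assms by (auto simp: Qp_def FactGroup_def RCOSETS_def padic_class_def)

lemma padic_class_in_Zp_iff:
  assumes s: "\<sigma> \<in> carrier (padic_cauchy p)"
  shows "padic_class \<sigma> \<in> Zp p \<longleftrightarrow> (\<exists>N. \<forall>n\<ge>N. padic_abs p (\<sigma> n) \<le> 1)"
proof
  assume "padic_class \<sigma> \<in> Zp p"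
  moreover have "\<sigma> \<in> padic_class \<sigma>"
    unfolding padic_class_def using padic_cauchy_group padic_null_subgroup s
    by (intro group.rcos_self) (auto simp: comm_group_def)
  ultimately show "\<exists>N. \<forall>n\<ge>N. padic_abs p (\<sigma> n) \<le> 1"
    using padic_lim_le_1_iff[OF s] by (simp add: Zp_def)
next
  assume "\<exists>N. \<forall>n\<ge>N. padic_abs p (\<sigma> n) \<le> 1"
  then obtain N where N: "\<And>n. n \<ge> N \<Longrightarrow> padic_abs p (\<sigma> n) \<le> 1" by blast
  have "lim (\<lambda>n. padic_abs p (\<tau> n)) \<le> 1" if t: "\<tau> \<in> padic_class \<sigma>" for \<tau>
  proof -
    obtain h where h: "h \<in> padic_null p" "\<tau> = (\<lambda>n. h n + \<sigma> n)"
      using t by (auto simp: padic_class_def r_coset_def)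
    have tc: "\<tau> \<in> carrier (padic_cauchy p)"
      unfolding h(2) using h(1) padic_null_subset s by (intro padic_cauchy_add) auto
    have "\<exists>N. \<forall>n\<ge>N. padic_abs p (h n) < 1"
      using h(1) unfolding padic_null_iff by (simp add: zero_less_one)
    then obtain N' where N': "\<And>n. n \<ge> N' \<Longrightarrow> padic_abs p (h n) < 1" by blast
    have "padic_abs p (\<tau> n) \<le> 1" if "n \<ge> max N N'" for n
      using padic_abs_add[OF p, of "h n" "\<sigma> n"] N[of n] N'[of n] that h(2) by simp
    then show ?thesis using padic_lim_le_1_iff[OF tc] by blast
  qed
  moreover have "padic_class \<sigma> \<in> carrier (Qp p)" using padic_class_hom s by (auto simp: hom_def)
  ultimately show "padic_class \<sigma> \<in> Zp p" by (simp add: Zp_def)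
qed

lemma Zp_subgroup: "subgroup (Zp p) (Qp p)"
proof (rule group.subgroupI)
  show "group (Qp p)" using Qp_group by (simp add: comm_group_def)
  show "Zp p \<subseteq> carrier (Qp p)" by (auto simp: Zp_def)
  have "padic_class (\<lambda>n. 0) \<in> Zp p" by (subst padic_class_in_Zp_iff[OF padic_cauchy_const]) simp
  then show "Zp p \<noteq> {}" by blast
next
  have gh: "group_hom (padic_cauchy p) (Qp p) padic_class"
    using padic_class_hom padic_cauchy_group Qp_group
    by (simp add: group_hom_def group_hom_axioms_def comm_group_def)
  fix X assume X: "X \<in> Zp p"
  then obtain \<sigma> where s: "\<sigma> \<in> carrier (padic_cauchy p)" "X = padic_class \<sigma>"
    using padic_class_surj unfolding Zp_def by blast
  have m: "(\<lambda>n. - \<sigma> n) \<in> carrier (padic_cauchy p)" using padic_cauchy_minus[OF s(1)] .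
  have "inv\<^bsub>padic_cauchy p\<^esub> \<sigma> = (\<lambda>n. - \<sigma> n)"
    using padic_cauchy_group s m
    by (intro group.inv_equality) (auto simp: comm_group_def)
  then have "inv\<^bsub>Qp p\<^esub> X = padic_class (\<lambda>n. - \<sigma> n)"
    using group_hom.hom_inv[OF gh s(1)] s(2) by simp
  then show "inv\<^bsub>Qp p\<^esub> X \<in> Zp p"
    using X s padic_class_in_Zp_iff[OF s(1)] padic_class_in_Zp_iff[OF m] by (simp add: padic_abs_minus[OF p])
  fix Y assume Y: "Y \<in> Zp p"
  then obtain \<tau> where t: "\<tau> \<in> carrier (padic_cauchy p)" "Y = padic_class \<tau>"
    using padic_class_surj unfolding Zp_def by blast
  have XY: "X \<otimes>\<^bsub>Qp p\<^esub> Y = padic_class (\<lambda>n. \<sigma> n + \<tau> n)"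
    using group_hom.hom_mult[OF gh s(1) t(1)] s(2) t(2) by simp
  obtain N where N: "\<And>n. n \<ge> N \<Longrightarrow> padic_abs p (\<sigma> n) \<le> 1"
    using X s padic_class_in_Zp_iff[OF s(1)] by blast
  obtain N' where N': "\<And>n. n \<ge> N' \<Longrightarrow> padic_abs p (\<tau> n) \<le> 1"
    using Y t padic_class_in_Zp_iff[OF t(1)] by blast
  have "padic_abs p (\<sigma> n + \<tau> n) \<le> 1" if "n \<ge> max N N'" for n
    using padic_abs_add[OF p, of "\<sigma> n" "\<tau> n"] N[of n] N'[of n] that by simp
  then show "X \<otimes>\<^bsub>Qp p\<^esub> Y \<in> Zp p"
    unfolding XY padic_class_in_Zp_iff[OF padic_cauchy_add[OF s(1) t(1)]] by blast
qed

lemma Zp_normal: "Zp p \<lhd> Qp p"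
  by (rule comm_group.subgroup_imp_normal[OF Qp_group Zp_subgroup])

lemma Qp_mod_Zp_group: "comm_group (Qp_mod_Zp p)"
  unfolding Qp_mod_Zp_def by (rule comm_group.abelian_FactGroup[OF Qp_group Zp_subgroup])

end

text \<open>By density of \<open>\<rat>\<close> in \<open>\<rat>\<^sub>p\<close>, the group \<open>\<rat>\<^sub>p / \<int>\<^sub>p\<close> is \<open>\<rat>\<close> modulo the rationals of absolute
  value at most 1; this map is the projection.\<close>

definition rat_class :: "nat \<Rightarrow> rat \<Rightarrow> (nat \<Rightarrow> rat) set set" where
  "rat_class p q = Zp p #>\<^bsub>Qp p\<^esub> padic_class p (\<lambda>n. q)"

context
  fixes p :: nat
  assumes p: "prime p"
begin

lemma rat_class_closed: "rat_class p q \<in> carrier (Qp_mod_Zp p)"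
proof -
  have "padic_class p (\<lambda>n. q) \<in> carrier (Qp p)"
    using padic_class_hom[OF p] padic_cauchy_const[OF p] by (auto simp: hom_def)
  then show ?thesis
    using normal.r_coset_hom_Mod[OF Zp_normal[OF p]] by (auto simp: hom_def Qp_mod_Zp_def rat_class_def)
qed

lemma rat_class_add: "rat_class p (q + r) = rat_class p q \<otimes>\<^bsub>Qp_mod_Zp p\<^esub> rat_class p r"
proof -
  have c: "padic_class p (\<lambda>n. q) \<in> carrier (Qp p)" for q
    using padic_class_hom[OF p] padic_cauchy_const[OF p] by (auto simp: hom_def)
  have "padic_class p (\<lambda>n. q + r) = padic_class p (\<lambda>n. q) \<otimes>\<^bsub>Qp p\<^esub> padic_class p (\<lambda>n. r)"
    using hom_mult[OF padic_class_hom[OF p] padic_cauchy_const[OF p] padic_cauchy_const[OF p], of q r]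
    by (simp add: padic_cauchy_simps[OF p])
  then show ?thesis
    using hom_mult[OF normal.r_coset_hom_Mod[OF Zp_normal[OF p]] c c, of q r]
    by (simp add: Qp_mod_Zp_def rat_class_def)
qed

lemma rat_class_eq_one_iff: "rat_class p q = \<one>\<^bsub>Qp_mod_Zp p\<^esub> \<longleftrightarrow> padic_abs p q \<le> 1"
proof -
  have c: "padic_class p (\<lambda>n. q) \<in> carrier (Qp p)"
    using padic_class_hom[OF p] padic_cauchy_const[OF p] by (auto simp: hom_def)
  have g: "group (Qp p)" using Qp_group[OF p] by (simp add: comm_group_def)
  have "rat_class p q = \<one>\<^bsub>Qp_mod_Zp p\<^esub> \<longleftrightarrow> padic_class p (\<lambda>n. q) \<in> Zp p"
    using group.coset_join1[OF g _ c Zp_subgroup[OF p]] group.coset_join2[OF g c Zp_subgroup[OF p]]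
    by (auto simp: rat_class_def Qp_mod_Zp_def FactGroup_def)
  then show ?thesis unfolding padic_class_in_Zp_iff[OF p padic_cauchy_const[OF p]] by auto
qed

lemma rat_class_eq_iff: "rat_class p q = rat_class p r \<longleftrightarrow> padic_abs p (q - r) \<le> 1"
proof -
  interpret Q: comm_group "Qp_mod_Zp p" by (rule Qp_mod_Zp_group[OF p])
  have "rat_class p q = rat_class p (q - r) \<otimes>\<^bsub>Qp_mod_Zp p\<^esub> rat_class p r"
    using rat_class_add[of "q - r" r] by simp
  then show ?thesis
    using rat_class_eq_one_iff[of "q - r"] rat_class_closed[of "q - r"] rat_class_closed[of r]
    by (metis Q.l_cancel_one' Q.l_one Q.r_cancel_one')
qed

lemma rat_class_surj:
  assumes "X \<in> carrier (Qp_mod_Zp p)"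
  obtains q where "X = rat_class p q"
proof -
  obtain Y where Y: "Y \<in> carrier (Qp p)" "X = Zp p #>\<^bsub>Qp p\<^esub> Y"
    using assms by (auto simp: Qp_mod_Zp_def FactGroup_def RCOSETS_def)
  obtain \<sigma> where s: "\<sigma> \<in> carrier (padic_cauchy p)" "Y = padic_class p \<sigma>"
    using padic_class_surj[OF p Y(1)] .
  obtain N where N: "\<And>n n'. N \<le> n \<Longrightarrow> N \<le> n' \<Longrightarrow> padic_abs p (\<sigma> n - \<sigma> n') < 1"
    using s(1) unfolding padic_cauchy_iff[OF p] by (meson zero_less_one)
  define \<tau> where "\<tau> = (\<lambda>n. \<sigma> n - \<sigma> N)"
  have t: "\<tau> \<in> carrier (padic_cauchy p)"
    using padic_cauchy_add[OF p s(1) padic_cauchy_const[OF p, of "- \<sigma> N"]] by (simp add: \<tau>_def)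
  have "padic_class p \<tau> \<in> Zp p"
    unfolding padic_class_in_Zp_iff[OF p t] using N[of _ N] by (auto simp: \<tau>_def intro: less_imp_le)
  moreover have "Y = padic_class p \<tau> \<otimes>\<^bsub>Qp p\<^esub> padic_class p (\<lambda>n. \<sigma> N)"
    using hom_mult[OF padic_class_hom[OF p] t padic_cauchy_const[OF p, of "\<sigma> N"]] s(2)
    by (simp add: padic_cauchy_simps[OF p] \<tau>_def)
  ultimately have "Y \<in> Zp p #>\<^bsub>Qp p\<^esub> padic_class p (\<lambda>n. \<sigma> N)"
    by (auto simp: r_coset_def)
  moreover have "padic_class p (\<lambda>n. \<sigma> N) \<in> carrier (Qp p)"
    using padic_class_hom[OF p] padic_cauchy_const[OF p] by (auto simp: hom_def)
  ultimately have "X = rat_class p (\<sigma> N)"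
    unfolding Y(2) rat_class_def
    using group.repr_independence[OF _ _ _ Zp_subgroup[OF p]] Qp_group[OF p]
    by (metis comm_group_def)
  then show thesis by (rule that)
qed

end

section \<open>Compactness in a local field\<close>

context local_field
begin

lemma av_0 [simp]: "av 0 = 0" by (simp add: av_eq_0_iff)

lemma av_pos: "x \<noteq> 0 \<Longrightarrow> 0 < av x"
  using av_nonneg[of x] av_eq_0_iff[of x] by linarith

lemma av_1 [simp]: "av 1 = 1"
  using av_mult[of 1 1] av_eq_0_iff[of 1] by simp

lemma av_minus [simp]: "av (- x) = av x"
proof -
  have "av (- 1) * av (- 1) = 1" using av_mult[of "-1" "-1"] by simp
  then have "av (- 1) = 1"
    using av_nonneg[of "-1"] by (simp add: power2_eq_square[symmetric] power2_eq_1_iff)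
  then show ?thesis using av_mult[of "-1" x] by simp
qed

lemma av_diff_commute: "av (x - y) = av (y - x)"
  using av_minus[of "x - y"] by simp

lemma av_diff_le_max: "av (x - y) \<le> max (av x) (av y)"
  using av_add_le_max[of x "- y"] by simp

lemma av_power: "av (x ^ n) = av x ^ n"
  by (induction n) (auto simp: av_mult)

lemma av_divide: "y \<noteq> 0 \<Longrightarrow> av (x / y) = av x / av y"
  using av_mult[of "x / y" y] av_pos[of y] by (simp add: field_simps)

lemma av_of_nat_le_1: "av (of_nat n) \<le> 1"
proof (induction n)
  case (Suc n) then show ?case using av_add_le_max[of 1 "of_nat n"] by simp
qed simp

lemma av_add_eq_max:
  assumes "av x \<noteq> av y"
  shows "av (x + y) = max (av x) (av y)"
  using assms av_add_le_max[of x y] av_diff_le_max[of "x + y" y] av_diff_le_max[of "x + y" x]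
  by (auto simp: max_def split: if_splits)

lemma av_sum_le:
  assumes "\<And>k. k \<in> A \<Longrightarrow> av (f k) \<le> B" "0 \<le> B"
  shows "av (sum f A) \<le> B"
  using assms
proof (induction A rule: infinite_finite_induct)
  case (insert x F)
  then show ?case using av_add_le_max[of "f x" "sum f F"] by fastforce
qed auto

lemma av_metric: "Metric_space UNIV (\<lambda>x y. av (x - y))"
proof
  fix x y z :: 'a
  show "av (x - z) \<le> av (x - y) + av (y - z)"
    using av_add_le_max[of "x - y" "y - z"] av_nonneg[of "x - y"] av_nonneg[of "y - z"] by simp
qed (auto simp: av_nonneg av_diff_commute av_eq_0_iff)

lemma av_reverse_triangle: "\<bar>av x - av y\<bar> \<le> av (x - y)"
  using av_add_le_max[of "x - y" y] av_add_le_max[of "y - x" x] av_diff_commute[of x y]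
    av_nonneg[of x] av_nonneg[of y] av_nonneg[of "x - y"]
  by (auto simp: max_def split: if_splits)

lemma openin_av_iff:
  "openin (av_topology av) T \<longleftrightarrow> (\<forall>x\<in>T. \<exists>r>0. \<forall>y. av (x - y) < r \<longrightarrow> y \<in> T)"
  unfolding av_topology_def Metric_space.openin_mtopology[OF av_metric]
  by (auto simp: Metric_space.mball_def[OF av_metric] subset_iff)

lemma exists_small: "\<exists>c. 0 < av c \<and> av c < 1"
proof (rule ccontr)
  assume "\<not> ?thesis"
  then have large: "1 \<le> av c" if "c \<noteq> 0" for c using that av_pos[of c] by force
  have "openin (av_topology av) T" for T
    unfolding openin_av_iff
  proof
    fix x assume "x \<in> T"
    have "y = x" if "av (x - y) < 1" for y using large[of "x - y"] that by force
    then show "\<exists>r>0. \<forall>y. av (x - y) < r \<longrightarrow> y \<in> T"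
      using \<open>x \<in> T\<close> by (intro exI[of _ 1]) auto
  qed
  then have "av_topology av = discrete_topology UNIV" by (simp add: topology_eq)
  then show False using non_discrete by simp
qed

text \<open>A compact neighbourhood of 0 contains a ball, and multiplication by a small element shrinks
  any bounded set into that ball. All uses of local compactness go through this lemma.\<close>

lemma bounded_convergent_subsequence:
  assumes B: "\<And>n. av (\<sigma> n) \<le> B"
  obtains l and r :: "nat \<Rightarrow> nat"
  where "strict_mono r" "(\<lambda>n. av (\<sigma> (r n) - l)) \<longlonglongrightarrow> 0"
proof -
  have top: "topspace (av_topology av) = UNIV"
    by (simp add: av_topology_def Metric_space.topspace_mtopology[OF av_metric])
  obtain V K where VK: "openin (av_topology av) V" "compactin (av_topology av) K" "0 \<in> V" "V \<subseteq> K"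
    using locally_compact unfolding locally_compact_space_def top by blast
  obtain \<epsilon> where e: "\<epsilon> > 0" "\<And>y. av y < \<epsilon> \<Longrightarrow> y \<in> K"
    using VK unfolding openin_av_iff by fastforce
  obtain c where c: "0 < av c" "av c < 1" using exists_small by blast
  have c0: "c \<noteq> 0" using c by auto
  have "(\<lambda>n. \<bar>B\<bar> * av c ^ n) \<longlonglongrightarrow> \<bar>B\<bar> * 0"
    using c by (intro tendsto_mult tendsto_const LIMSEQ_realpow_zero) auto
  then have "\<forall>\<^sub>F n in sequentially. \<bar>B\<bar> * av c ^ n < \<epsilon>"
    using e(1) by (intro order_tendstoD(2)) auto
  then obtain m where m: "\<bar>B\<bar> * av c ^ m < \<epsilon>" unfolding eventually_sequentially by blast
  define \<tau> where "\<tau> = (\<lambda>n. c ^ m * \<sigma> n)"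
  have "\<tau> n \<in> K" for n
  proof (rule e(2))
    have "av (\<tau> n) \<le> av c ^ m * \<bar>B\<bar>"
      unfolding \<tau>_def av_mult av_power using B[of n] c by (intro mult_left_mono) auto
    then show "av (\<tau> n) < \<epsilon>" using m by (simp add: mult.commute)
  qed
  then obtain l r where lr: "strict_mono (r :: nat \<Rightarrow> nat)"
      "limitin (Metric_space.mtopology UNIV (\<lambda>x y. av (x - y))) (\<tau> \<circ> r) l sequentially"
    using VK(2) unfolding av_topology_def Metric_space.compactin_sequentially[OF av_metric] by blast
  have lim: "(\<lambda>n. av (\<tau> (r n) - l)) \<longlonglongrightarrow> 0"
    unfolding LIMSEQ_iff
    using lr(2) unfolding Metric_space.limit_metric_sequentially[OF av_metric]
    by (simp add: av_nonneg abs_of_nonneg)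
  have "av (\<sigma> (r n) - l / c ^ m) = av (\<tau> (r n) - l) * (1 / av c ^ m)" for n
  proof -
    have "\<tau> (r n) - l = c ^ m * (\<sigma> (r n) - l / c ^ m)" using c0 by (simp add: \<tau>_def field_simps)
    then have "av (\<tau> (r n) - l) = av c ^ m * av (\<sigma> (r n) - l / c ^ m)" by (simp only: av_mult av_power)
    then show ?thesis using c(1) by simp
  qed
  moreover have "(\<lambda>n. av (\<tau> (r n) - l) * (1 / av c ^ m)) \<longlonglongrightarrow> 0 * (1 / av c ^ m)"
    by (intro tendsto_mult lim tendsto_const)
  ultimately show thesis using that[OF lr(1), of "l / c ^ m"] by simp
qed

definition unif_abs :: real where "unif_abs = (SUP y\<in>max_ideal av. av y)"

text \<open>A maximising sequence for the supremum has a convergent subsequence, whose limit is again in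
  the maximal ideal; so the supremum is attained.\<close>

lemma uniformizer:
  obtains \<pi> where "av \<pi> = unif_abs" "0 < unif_abs" "unif_abs < 1" "\<And>x. av x < 1 \<Longrightarrow> av x \<le> unif_abs"
proof -
  have bdd: "bdd_above (av ` max_ideal av)"
    by (rule bdd_aboveI[of _ 1]) (auto simp: max_ideal_def)
  have upper: "av x \<le> unif_abs" if "av x < 1" for x
    unfolding unif_abs_def using bdd that by (intro cSUP_upper) (auto simp: max_ideal_def)
  obtain c where c: "0 < av c" "av c < 1" using exists_small by blast
  have pos: "0 < unif_abs" using upper[OF c(2)] c(1) by linarith
  have "\<exists>x. av x < 1 \<and> unif_abs - 1 / real (Suc n) < av x" for n
  proof -
    have "unif_abs - 1 / real (Suc n) < (SUP y\<in>max_ideal av. av y)" by (simp add: unif_abs_def)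
    moreover have "max_ideal av \<noteq> {}" using c by (auto simp: max_ideal_def)
    ultimately obtain x where "x \<in> max_ideal av" "unif_abs - 1 / real (Suc n) < av x"
      using less_cSUP_iff[OF _ bdd] by blast
    then show ?thesis by (auto simp: max_ideal_def)
  qed
  then obtain \<sigma> where s: "\<And>n. av (\<sigma> n) < 1" "\<And>n. unif_abs - 1 / real (Suc n) < av (\<sigma> n)" by metis
  obtain l r where lr: "strict_mono (r :: nat \<Rightarrow> nat)" "(\<lambda>n. av (\<sigma> (r n) - l)) \<longlonglongrightarrow> 0"
    using bounded_convergent_subsequence[of \<sigma> 1] s(1) by (metis less_imp_le)
  have "\<forall>\<^sub>F n in sequentially. av (\<sigma> (r n) - l) < 1" using lr(2) by (intro order_tendstoD(2)) auto
  then obtain m where m: "av (\<sigma> (r m) - l) < 1" unfolding eventually_sequentially by blast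
  have l1: "av l < 1"
    using av_diff_le_max[of "\<sigma> (r m)" "\<sigma> (r m) - l"] m s(1)[of "r m"] by simp
  have "unif_abs \<le> av l + 0 + 0"
  proof (rule LIMSEQ_le_const)
    show "(\<lambda>n. av l + av (\<sigma> (r n) - l) + 1 / real (Suc n)) \<longlonglongrightarrow> av l + 0 + 0"
      using lr(2) LIMSEQ_inverse_real_of_nat by (intro tendsto_add) (auto simp: inverse_eq_divide)
    have "unif_abs \<le> av l + av (\<sigma> (r n) - l) + 1 / real (Suc n)" for n
    proof -
      have "1 / real (Suc (r n)) \<le> 1 / real (Suc n)"
        using strict_mono_imp_increasing[OF lr(1), of n] by (simp add: frac_le)
      then show ?thesis using s(2)[of "r n"] av_reverse_triangle[of "\<sigma> (r n)" l] by linarith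
    qed
    then show "\<exists>N. \<forall>n\<ge>N. unif_abs \<le> av l + av (\<sigma> (r n) - l) + 1 / real (Suc n)" by blast
  qed
  then have "av l = unif_abs" using upper[OF l1] by simp
  then show thesis using that[of l] pos l1 upper by simp
qed

lemma unif_abs_pos: "0 < unif_abs" and unif_abs_less_1: "unif_abs < 1"
  and av_le_unif_abs: "av x < 1 \<Longrightarrow> av x \<le> unif_abs"
  using uniformizer by metis+

lemma unif_abs_power_le_iff: "unif_abs ^ m \<le> unif_abs ^ n \<longleftrightarrow> n \<le> m"
  using unif_abs_pos unif_abs_less_1 by (rule power_decreasing_iff)

text \<open>The absolute values are discrete: none lies strictly between consecutive powers of
  \<open>unif_abs\<close>.\<close>

lemma av_ge_unif_abs_power:
  assumes "unif_abs ^ Suc n < av x"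
  shows "unif_abs ^ n \<le> av x"
proof -
  obtain \<pi> where pi: "av \<pi> = unif_abs" by (rule uniformizer)
  have "0 < unif_abs ^ Suc n" using unif_abs_pos by simp
  then have x0: "x \<noteq> 0" "0 < av x" using assms av_pos by auto
  have "av (\<pi> ^ Suc n / x) < 1"
    using assms x0 by (simp add: av_divide av_power av_mult pi)
  then have "av (\<pi> ^ Suc n / x) \<le> unif_abs" by (rule av_le_unif_abs)
  then have "unif_abs ^ Suc n \<le> unif_abs * av x"
    using x0 by (simp add: av_divide av_power av_mult pi field_simps)
  then show ?thesis using unif_abs_pos by simp
qed

lemma av_eq_unif_abs_power:
  assumes "x \<noteq> 0" "av x \<le> 1"
  obtains n where "av x = unif_abs ^ n"
proof -
  have "(\<lambda>n. unif_abs ^ n) \<longlonglongrightarrow> 0"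
    using unif_abs_pos unif_abs_less_1 by (intro LIMSEQ_realpow_zero) auto
  then have "\<forall>\<^sub>F n in sequentially. unif_abs ^ n < av x"
    using av_pos[OF assms(1)] by (intro order_tendstoD(2)) auto
  then obtain m where m: "unif_abs ^ m < av x" unfolding eventually_sequentially by blast
  define k where "k = (LEAST k. unif_abs ^ k < av x)"
  have k: "unif_abs ^ k < av x" unfolding k_def by (rule LeastI[of _ m]) (rule m)
  have "k \<noteq> 0" using k assms(2) by (metis not_le power_0)
  then obtain n where n: "k = Suc n" by (cases k) auto
  have "\<not> unif_abs ^ n < av x" using not_less_Least[of n "\<lambda>k. unif_abs ^ k < av x"] n k_def by simp
  then show thesis using that[of n] av_ge_unif_abs_power[of n x] k n by simp
qed

lemma normalized_val_eq:
  assumes "av x = unif_abs ^ n"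
  shows "normalized_val av x = int n"
  unfolding normalized_val_def unif_abs_def[symmetric]
proof (rule the_equality)
  show "av x = unif_abs powi int n" using assms by simp
  fix m assume "av x = unif_abs powi m"
  then have "unif_abs powi m = unif_abs powi (int n)" using assms by simp
  then show "m = int n"
    using power_int_strict_decreasing[OF _ unif_abs_pos unif_abs_less_1, of m "int n"]
      power_int_strict_decreasing[OF _ unif_abs_pos unif_abs_less_1, of "int n" m]
    by (cases m "int n" rule: linorder_cases) auto
qed

text \<open>Representatives of distinct residue classes have mutual distance 1, so an infinite set of
  them would contain a sequence without convergent subsequence.\<close>

lemma finite_residue_system:
  obtains R where "finite R" "\<And>r. r \<in> R \<Longrightarrow> av r \<le> 1"
    "\<And>x. av x \<le> 1 \<Longrightarrow> \<exists>r\<in>R. av (x - r) < 1"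
    "\<And>r s. r \<in> R \<Longrightarrow> s \<in> R \<Longrightarrow> av (r - s) < 1 \<Longrightarrow> r = s"
proof -
  define f where "f = (\<lambda>x. SOME y. av (y - x) < 1)"
  have f: "av (f x - x) < 1" for x unfolding f_def by (rule someI[of _ x]) simp
  have f_eq: "f x = f y" if "av (x - y) < 1" for x y
  proof -
    have "av (z - x) < 1 \<longleftrightarrow> av (z - y) < 1" for z
      using that av_add_le_max[of "z - x" "x - y"] av_diff_le_max[of "z - y" "x - y"] by auto
    then show ?thesis by (simp add: f_def)
  qed
  define R where "R = f ` {x. av x \<le> 1}"
  have sep: "r = s" if rs: "r \<in> R" "s \<in> R" "av (r - s) < 1" for r s
  proof -
    obtain x y where xy: "r = f x" "s = f y" using rs unfolding R_def by blast
    have "f r = r" "f s = s" unfolding xy by (rule f_eq[OF f])+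
    then show ?thesis using f_eq[OF rs(3)] by metis
  qed
  have int: "av r \<le> 1" if r: "r \<in> R" for r
  proof -
    obtain x where "r = f x" "av x \<le> 1" using r by (auto simp: R_def)
    then show ?thesis using f[of x] av_add_le_max[of "f x - x" x] by simp
  qed
  have "finite R"
  proof (rule ccontr)
    assume "infinite R"
    then obtain \<sigma> where s: "inj (\<sigma> :: nat \<Rightarrow> 'a)" "range \<sigma> \<subseteq> R"
      using infinite_countable_subset by blast
    obtain l r where lr: "strict_mono (r :: nat \<Rightarrow> nat)" "(\<lambda>n. av (\<sigma> (r n) - l)) \<longlonglongrightarrow> 0"
      using bounded_convergent_subsequence[of \<sigma> 1] int s(2) by (metis UNIV_I image_subset_iff)
    have "\<forall>\<^sub>F n in sequentially. av (\<sigma> (r n) - l) < 1" using lr(2) by (intro order_tendstoD(2)) auto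
    then obtain m where m: "av (\<sigma> (r m) - l) < 1" "av (\<sigma> (r (Suc m)) - l) < 1"
      unfolding eventually_sequentially by (meson le_SucI order_refl)
    have "av (\<sigma> (r m) - \<sigma> (r (Suc m))) < 1"
      using av_diff_le_max[of "\<sigma> (r m) - l" "\<sigma> (r (Suc m)) - l"] m by simp
    then have "\<sigma> (r m) = \<sigma> (r (Suc m))" using sep s(2) by blast
    then have "r m = r (Suc m)" using s(1) by (simp add: inj_eq)
    then show False using lr(1) by (simp add: strict_mono_Suc_iff less_imp_neq)
  qed
  moreover have "\<exists>r\<in>R. av (x - r) < 1" if "av x \<le> 1" for x
    using f[of x] that by (intro bexI[of _ "f x"]) (auto simp: R_def av_diff_commute)
  ultimately show thesis using that int sep by blast
qed


section \<open>The unit filtration and the residue characteristic\<close>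

lemma int_ring_simps [simp]:
  "carrier (int_ring av) = {x. av x \<le> 1}" "mult (int_ring av) = (*)" "one (int_ring av) = 1"
  "zero (int_ring av) = 0" "add (int_ring av) = (+)"
  by (simp_all add: int_ring_def)

lemma int_ring_cring: "cring (int_ring av)"
proof (rule cringI)
  show "abelian_group (int_ring av)"
  proof (rule abelian_groupI)
    fix x assume "x \<in> carrier (int_ring av)"
    then show "\<exists>y\<in>carrier (int_ring av). y \<oplus>\<^bsub>int_ring av\<^esub> x = \<zero>\<^bsub>int_ring av\<^esub>"
      by (intro bexI[of _ "- x"]) auto
  next
    fix x y assume "x \<in> carrier (int_ring av)" "y \<in> carrier (int_ring av)"
    then show "x \<oplus>\<^bsub>int_ring av\<^esub> y \<in> carrier (int_ring av)"
      using av_add_le_max[of x y] by simp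
  qed (auto simp: algebra_simps)
  show "Group.comm_monoid (int_ring av)"
    by (rule comm_monoidI) (auto simp: av_mult algebra_simps mult_le_one av_nonneg)
qed (auto simp: algebra_simps)

lemma max_ideal_ideal: "ideal (max_ideal av) (int_ring av)"
proof -
  interpret R: cring "int_ring av" by (rule int_ring_cring)
  have minus: "inv\<^bsub>add_monoid (int_ring av)\<^esub> x = - x" if "av x \<le> 1" for x
    using that by (intro group.inv_equality[OF R.a_group]) auto
  show ?thesis
  proof (rule idealI)
    show "subgroup (max_ideal av) (add_monoid (int_ring av))"
    proof (rule group.subgroupI[OF R.a_group])
      show "max_ideal av \<noteq> {}" by (auto simp: max_ideal_def intro: exI[of _ 0])
      fix x assume x: "x \<in> max_ideal av"
      then show "inv\<^bsub>add_monoid (int_ring av)\<^esub> x \<in> max_ideal av" by (subst minus) (auto simp: max_ideal_def)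
      fix y assume "y \<in> max_ideal av"
      then show "x \<otimes>\<^bsub>add_monoid (int_ring av)\<^esub> y \<in> max_ideal av"
        using x av_add_le_max[of x y] by (simp add: max_ideal_def)
    qed (auto simp: max_ideal_def)
    have "av (x * a) < 1" if "av a < 1" "av x \<le> 1" for a x
      unfolding av_mult using that mult_left_le_one_le[of "av a" "av x"] av_nonneg[of a] av_nonneg[of x] by linarith
    then show "\<And>a x. a \<in> max_ideal av \<Longrightarrow> x \<in> carrier (int_ring av) \<Longrightarrow> x \<otimes>\<^bsub>int_ring av\<^esub> a \<in> max_ideal av"
      "\<And>a x. a \<in> max_ideal av \<Longrightarrow> x \<in> carrier (int_ring av) \<Longrightarrow> a \<otimes>\<^bsub>int_ring av\<^esub> x \<in> max_ideal av"
      by (auto simp: max_ideal_def mult.commute)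
  qed (rule R.ring_axioms)
qed

lemma residue_char_dvd_iff:
  assumes "has_residue_char av p"
  shows "av (of_nat n) < 1 \<longleftrightarrow> p dvd n"
proof -
  interpret I: ideal "max_ideal av" "int_ring av" by (rule max_ideal_ideal)
  let ?k = "int_ring av Quot max_ideal av"
  interpret K: ring ?k by (rule I.quotient_is_ring)
  have add: "(max_ideal av +>\<^bsub>int_ring av\<^esub> x) \<oplus>\<^bsub>?k\<^esub> (max_ideal av +>\<^bsub>int_ring av\<^esub> y)
      = max_ideal av +>\<^bsub>int_ring av\<^esub> (x + y)" if "av x \<le> 1" "av y \<le> 1" for x y
    using I.a_rcos_sum[of x y] that by (simp add: FactRing_def)
  have "[n] \<cdot>\<^bsub>?k\<^esub> \<one>\<^bsub>?k\<^esub> = max_ideal av +>\<^bsub>int_ring av\<^esub> of_nat n"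
  proof (induction n)
    case 0
    have "max_ideal av +>\<^bsub>int_ring av\<^esub> 0 = max_ideal av"
      by (auto simp: a_r_coset_def r_coset_def)
    then show ?case using K.add.nat_pow_0[of "\<one>\<^bsub>?k\<^esub>"] by (simp add: FactRing_def)
  next
    case (Suc n)
    have "\<one>\<^bsub>?k\<^esub> = max_ideal av +>\<^bsub>int_ring av\<^esub> 1" by (simp add: FactRing_def)
    then have "[Suc n] \<cdot>\<^bsub>?k\<^esub> \<one>\<^bsub>?k\<^esub> = max_ideal av +>\<^bsub>int_ring av\<^esub> (of_nat n + 1)"
      using Suc add[of "of_nat n" 1] K.add.nat_pow_Suc[of n "\<one>\<^bsub>?k\<^esub>"] av_of_nat_le_1[of n]
      by simp
    then show ?case by (simp add: add.commute)
  qed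
  moreover have "max_ideal av +>\<^bsub>int_ring av\<^esub> of_nat n = max_ideal av \<longleftrightarrow> of_nat n \<in> max_ideal av"
    using I.a_coset_join1[of "max_ideal av" "of_nat n"] I.a_coset_join2[of "of_nat n" "max_ideal av"]
      I.a_subgroup av_of_nat_le_1[of n] by auto
  moreover have "[n] \<cdot>\<^bsub>?k\<^esub> \<one>\<^bsub>?k\<^esub> = \<zero>\<^bsub>?k\<^esub> \<longleftrightarrow> p dvd n"
    using assms unfolding has_residue_char_def Let_def by blast
  moreover have "\<zero>\<^bsub>?k\<^esub> = max_ideal av" by (simp add: FactRing_def)
  ultimately have "of_nat n \<in> max_ideal av \<longleftrightarrow> p dvd n" by metis
  then show ?thesis by (simp add: max_ideal_def)
qed

text \<open>As the residue field is finite, its characteristic is not 0; multiplicativity of the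
  absolute value makes it prime.\<close>

lemma residue_char_prime:
  assumes "has_residue_char av p"
  shows "prime p"
proof -
  note dvd = residue_char_dvd_iff[OF assms]
  obtain R where R: "finite R" "\<And>r. r \<in> R \<Longrightarrow> av r \<le> 1" "\<And>x. av x \<le> 1 \<Longrightarrow> \<exists>r\<in>R. av (x - r) < 1"
    by (rule finite_residue_system) blast
  \<comment> \<open>two natural numbers lie in the same residue class, which excludes characteristic 0\<close>
  obtain g where g: "\<And>n::nat. g n \<in> R" "\<And>n. av (of_nat n - g n) < 1"
    using R(3)[OF av_of_nat_le_1] by metis
  have "\<not> inj g" using R(1) g(1) by (metis finite_imageD finite_subset image_subsetI infinite_UNIV_nat)
  then obtain m n where mn: "m < n" "g m = g n" unfolding inj_def by (metis linorder_neqE)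
  have "av (of_nat n - of_nat m) < 1"
    using av_diff_le_max[of "of_nat n - g n" "of_nat m - g n"] g(2)[of m] g(2)[of n] mn(2) by simp
  then have "p dvd n - m" using mn(1) dvd[of "n - m"] by (simp add: of_nat_diff)
  then have "p \<noteq> 0" using mn(1) by (intro notI) simp
  moreover have "p \<noteq> 1" using dvd[of 1] by auto
  moreover have "p dvd a \<or> p dvd b" if "p dvd a * b" for a b
  proof (rule ccontr)
    assume "\<not> ?thesis"
    then have "av (of_nat a) = 1" "av (of_nat b) = 1"
      using dvd[of a] dvd[of b] av_of_nat_le_1[of a] av_of_nat_le_1[of b] by auto
    then show False using that dvd[of "a * b"] by (simp add: av_mult)
  qed
  ultimately show ?thesis unfolding prime_def prime_elem_def by auto
qed

lemma max_ideal_power: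
  "max_ideal av [^]\<^bsub>ideals_set (int_ring av)\<^esub> (i::nat) = {x. av x \<le> unif_abs ^ i}"
proof (induction i)
  case 0
  then show ?case by (simp add: ideals_set_def nat_pow_def)
next
  case (Suc i)
  obtain \<pi> where pi: "av \<pi> = unif_abs" by (rule uniformizer)
  have "{x. av x \<le> unif_abs ^ i} \<cdot>\<^bsub>int_ring av\<^esub> max_ideal av = {x. av x \<le> unif_abs ^ Suc i}"
  proof (intro equalityI subsetI)
    fix x assume "x \<in> {x. av x \<le> unif_abs ^ i} \<cdot>\<^bsub>int_ring av\<^esub> max_ideal av"
    then show "x \<in> {x. av x \<le> unif_abs ^ Suc i}"
    proof (induction rule: ideal_prod.induct)
      case (prod a b)
      then have "av a * av b \<le> unif_abs ^ i * unif_abs"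
        using av_le_unif_abs[of b] unif_abs_pos
        by (intro mult_mono) (auto simp: max_ideal_def av_nonneg)
      then show ?case by (simp add: av_mult mult.commute)
    next
      case (sum a b) then show ?case using av_add_le_max[of a b] by auto
    qed
  next
    fix x assume x: "x \<in> {x. av x \<le> unif_abs ^ Suc i}"
    have pi0: "\<pi> \<noteq> 0" using pi unif_abs_pos by auto
    have "av (x / \<pi>) \<le> unif_abs ^ i"
      using x unif_abs_pos by (simp add: av_divide[OF pi0] pi field_simps)
    moreover have "\<pi> \<in> max_ideal av" using pi unif_abs_less_1 by (simp add: max_ideal_def)
    ultimately have "x / \<pi> \<otimes>\<^bsub>int_ring av\<^esub> \<pi> \<in> {x. av x \<le> unif_abs ^ i} \<cdot>\<^bsub>int_ring av\<^esub> max_ideal av"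
      by (intro ideal_prod.prod) auto
    then show "x \<in> {x. av x \<le> unif_abs ^ i} \<cdot>\<^bsub>int_ring av\<^esub> max_ideal av" using pi0 by simp
  qed
  moreover have "max_ideal av [^]\<^bsub>ideals_set (int_ring av)\<^esub> Suc i
      = (max_ideal av [^]\<^bsub>ideals_set (int_ring av)\<^esub> i) \<cdot>\<^bsub>int_ring av\<^esub> max_ideal av"
    by (simp add: ideals_set_def nat_pow_def)
  ultimately show ?case using Suc by simp
qed

lemma unit_filt_iff: "u \<in> unit_filt av i \<longleftrightarrow> av (u - 1) \<le> unif_abs ^ i"
proof
  assume "av (u - 1) \<le> unif_abs ^ i"
  then have "1 + (u - 1) \<in> unit_filt av i" unfolding unit_filt_def max_ideal_power by blast
  then show "u \<in> unit_filt av i" by simp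
qed (auto simp: unit_filt_def max_ideal_power)

end

section \<open>Taking p-th powers of units\<close>

context local_field
begin

lemma unit_filt_av:
  assumes "u \<in> unit_filt av i" "1 \<le> i"
  shows "av u = 1" "u \<noteq> 0" "av (u - 1) < 1"
proof -
  have "unif_abs ^ i < 1" using assms(2) unif_abs_pos unif_abs_less_1 by (intro power_less_one_iff[THEN iffD2]) auto
  then show lt: "av (u - 1) < 1" using assms(1) unfolding unit_filt_iff by linarith
  then show "av u = 1" using av_add_eq_max[of "u - 1" 1] by simp
  then show "u \<noteq> 0" by auto
qed

lemma unit_filt_antimono: "i \<le> j \<Longrightarrow> unit_filt av j \<subseteq> unit_filt av i"
  using unif_abs_power_le_iff[of j i] by (auto simp: unit_filt_iff intro: order_trans)

lemma unit_filt_one: "1 \<in> unit_filt av i"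
  using unif_abs_pos by (simp add: unit_filt_iff)

lemma unit_filt_divide_iff:
  assumes "av v = 1"
  shows "u / v \<in> unit_filt av i \<longleftrightarrow> av (u - v) \<le> unif_abs ^ i"
proof -
  have v: "v \<noteq> 0" using assms by auto
  have "u / v - 1 = (u - v) / v" using v by (simp add: field_simps)
  then show ?thesis using assms v by (simp add: unit_filt_iff av_divide)
qed

lemma unit_filt_mult:
  assumes "u \<in> unit_filt av i" "v \<in> unit_filt av i" "1 \<le> i"
  shows "u * v \<in> unit_filt av i"
proof -
  have eq: "u * v - 1 = u * (v - 1) + (u - 1)" by (simp add: algebra_simps)
  have "av (u * (v - 1)) = av (v - 1)" using unit_filt_av(1)[OF assms(1,3)] by (simp add: av_mult)
  then show ?thesis
    using assms av_add_le_max[of "u * (v - 1)" "u - 1"] unfolding unit_filt_iff eq by simp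
qed

lemma unit_filt_inverse:
  assumes "u \<in> unit_filt av i" "1 \<le> i"
  shows "inverse u \<in> unit_filt av i"
  using unit_filt_divide_iff[OF unit_filt_av(1)[OF assms], of 1 i] assms(1)
  by (simp add: unit_filt_iff av_diff_commute inverse_eq_divide)

lemma unit_filt_divide:
  assumes "u \<in> unit_filt av i" "v \<in> unit_filt av i" "1 \<le> i"
  shows "u / v \<in> unit_filt av i"
  using unit_filt_mult[OF assms(1) unit_filt_inverse[OF assms(2,3)] assms(3)] by (simp add: divide_inverse)

lemma unit_filt_exact:
  assumes "u \<in> unit_filt av i" "u \<notin> unit_filt av (Suc i)"
  shows "av (u - 1) = unif_abs ^ i"
  using assms av_ge_unif_abs_power[of i "u - 1"] by (simp add: unit_filt_iff)

text \<open>The leading digit of the expansion of a unit in powers of a uniformizer.\<close>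

lemma unit_filt_digit:
  assumes R: "\<And>x. av x \<le> 1 \<Longrightarrow> \<exists>r\<in>R. av (x - r) < 1" and pi: "av \<pi> = unif_abs"
    and z: "z \<in> unit_filt av k"
  shows "\<exists>s\<in>R. av (z - (1 + s * \<pi> ^ k)) \<le> unif_abs ^ Suc k"
proof -
  have pi0: "\<pi> \<noteq> 0" using pi unif_abs_pos by auto
  have "av ((z - 1) / \<pi> ^ k) \<le> 1"
    using z pi0 unif_abs_pos by (simp add: unit_filt_iff av_divide av_power pi)
  then obtain s where s: "s \<in> R" "av ((z - 1) / \<pi> ^ k - s) < 1" using R by blast
  have "z - (1 + s * \<pi> ^ k) = ((z - 1) / \<pi> ^ k - s) * \<pi> ^ k" using pi0 by (simp add: field_simps)
  then have "av (z - (1 + s * \<pi> ^ k)) = av ((z - 1) / \<pi> ^ k - s) * unif_abs ^ k"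
    by (simp only: av_mult av_power pi)
  also have "\<dots> \<le> unif_abs * unif_abs ^ k"
    using av_le_unif_abs[OF s(2)] unif_abs_pos by (intro mult_right_mono) auto
  finally show ?thesis using s(1) by auto
qed

text \<open>The binomial coefficients other than the two outer ones are divisible by the prime \<open>p\<close>, and of
  their terms \<open>p * x\<close> dominates the rest; so only \<open>x ^ p\<close> and \<open>p * x\<close> matter.\<close>

lemma one_plus_power_prime:
  assumes p: "prime p" and x: "av x < 1"
  obtains g where "av g = 1" "(1 + x) ^ p = 1 + x ^ p + of_nat p * x * g"
proof -
  define d where "d = (\<lambda>k. (p choose k) div p)"
  have d: "p choose k = p * d k" if "k \<in> {1..<p}" for k
    using dvd_choose_prime[of k p] that p by (simp add: d_def)
  have p2: "p \<ge> 2" using prime_ge_2_nat[OF p] .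
  define h where "h = (\<Sum>k\<in>{2..<p}. of_nat (d k) * x ^ (k - 1))"
  have h: "av h < 1"
  proof -
    have "av (of_nat (d k) * x ^ (k - 1)) \<le> av x" if k: "k \<in> {2..<p}" for k
    proof -
      have m: "k - 1 = Suc (k - 2)" using k by auto
      have "av x ^ (k - 2) \<le> 1" using x av_nonneg by (intro power_le_one) auto
      then have "av (of_nat (d k)) * (av x * av x ^ (k - 2)) \<le> 1 * (av x * 1)"
        using av_of_nat_le_1 av_nonneg by (intro mult_mono) auto
      then show ?thesis unfolding av_mult av_power m power_Suc by simp
    qed
    then have "av h \<le> av x" unfolding h_def by (intro av_sum_le) (auto simp: av_nonneg)
    then show ?thesis using x by simp
  qed
  have d1: "d 1 = 1" using p2 by (simp add: d_def)
  have sets: "{..p} = insert 0 (insert p {1..<p})" "{1..<p} = insert 1 {2..<p}" using p2 by auto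
  have "(1 + x) ^ p = (\<Sum>k\<le>p. of_nat (p choose k) * x ^ k)"
    using binomial_ring[of x 1 p] by (simp add: add.commute)
  also have "\<dots> = 1 + x ^ p + (\<Sum>k\<in>{1..<p}. of_nat (p choose k) * x ^ k)"
    using p2 unfolding sets(1) by (subst sum.insert; simp)+
  also have "(\<Sum>k\<in>{1..<p}. of_nat (p choose k) * x ^ k)
      = (\<Sum>k\<in>{1..<p}. of_nat p * x * (of_nat (d k) * x ^ (k - 1)))"
  proof (rule sum.cong)
    fix k assume k: "k \<in> {1..<p}"
    then have "x ^ k = x * x ^ (k - 1)" by (simp flip: power_Suc)
    then show "of_nat (p choose k) * x ^ k = of_nat p * x * (of_nat (d k) * x ^ (k - 1))"
      unfolding d[OF k] by (simp add: algebra_simps)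
  qed simp
  also have "\<dots> = of_nat p * x * (1 + h)"
    unfolding sum_distrib_left[symmetric] sets(2) h_def using d1 by (subst sum.insert) auto
  finally have "(1 + x) ^ p = 1 + x ^ p + of_nat p * x * (1 + h)" .
  moreover have "av (1 + h) = 1" using av_add_eq_max[of 1 h] h by simp
  ultimately show thesis using that by blast
qed

end

locale local_field_residue_char = local_field +
  fixes p :: nat
  assumes residue_char: "has_residue_char av p"
begin

lemma p_prime: "prime p"
  by (rule residue_char_prime[OF residue_char])

definition shift :: "nat \<Rightarrow> nat" where "shift = rho (ram_index av p) p"

lemma shift_char_p:
  assumes "(of_nat p :: 'a) = 0"
  shows "shift i = p * i"
  using assms by (simp add: shift_def rho_def ram_index_def)

lemma shift_char_0:
  assumes "(of_nat p :: 'a) \<noteq> 0"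
  obtains e where "1 \<le> e" "av (of_nat p) = unif_abs ^ e" "\<And>i. shift i = min (i + e) (p * i)"
proof -
  obtain e where e: "av (of_nat p) = unif_abs ^ e"
    using av_eq_unif_abs_power[OF assms av_of_nat_le_1] .
  have "av (of_nat p) < 1" using residue_char_dvd_iff[OF residue_char, of p] by simp
  then have "e \<noteq> 0" using e by (metis less_irrefl power_0)
  moreover have "shift i = min (i + e) (p * i)" for i
    using assms normalized_val_eq[OF e] by (simp add: shift_def rho_def ram_index_def min_def)
  ultimately show thesis using that[of e] e by simp
qed

lemma shift_cases:
  obtains "(of_nat p :: 'a) = 0" "\<And>i. shift i = p * i"
  | e where "(of_nat p :: 'a) \<noteq> 0" "1 \<le> e" "av (of_nat p) = unif_abs ^ e" "\<And>i. shift i = min (i + e) (p * i)"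
  using shift_char_p shift_char_0 by metis

lemma shift_strict_mono:
  assumes "i < j"
  shows "shift i < shift j"
proof -
  have "p * i < p * j" using assms prime_gt_0_nat[OF p_prime] by simp
  then have "min (i + e) (p * i) < p * j" for e by linarith
  then show ?thesis using assms prime_gt_0_nat[OF p_prime] by (cases rule: shift_cases) auto
qed

lemma shift_gt: "1 \<le> i \<Longrightarrow> i < shift i"
  using prime_ge_2_nat[OF p_prime] n_less_m_mult_n[of i p] by (cases rule: shift_cases) auto

lemma av_p_times_le: "av (of_nat p) * unif_abs ^ i \<le> unif_abs ^ shift i"
proof (cases rule: shift_cases)
  case 1 then show ?thesis using unif_abs_pos by simp
next
  case (2 e)
  then show ?thesis using unif_abs_power_le_iff[of "e + i" "shift i"] by (simp add: power_add)
qed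

lemma shift_le: "shift i \<le> p * i"
  by (cases rule: shift_cases) auto

lemma unit_filt_power:
  assumes "u \<in> unit_filt av i" "1 \<le> i"
  shows "u ^ p \<in> unit_filt av (shift i)"
proof -
  obtain g where g: "av g = 1" "(1 + (u - 1)) ^ p = 1 + (u - 1) ^ p + of_nat p * (u - 1) * g"
    using one_plus_power_prime[OF p_prime unit_filt_av(3)[OF assms]] .
  have "av ((u - 1) ^ p) \<le> (unif_abs ^ i) ^ p"
    using assms unfolding av_power unit_filt_iff by (intro power_mono) (auto simp: av_nonneg)
  also have "\<dots> \<le> unif_abs ^ shift i"
    using shift_le[of i] unif_abs_power_le_iff by (simp add: power_mult[symmetric] mult.commute)
  finally have a: "av ((u - 1) ^ p) \<le> unif_abs ^ shift i" .
  have "av (of_nat p * (u - 1) * g) \<le> av (of_nat p) * unif_abs ^ i"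
    using assms g(1) by (simp add: av_mult unit_filt_iff mult_left_mono av_nonneg)
  also have "\<dots> \<le> unif_abs ^ shift i" by (rule av_p_times_le)
  finally have "av ((u - 1) ^ p + of_nat p * (u - 1) * g) \<le> unif_abs ^ shift i"
    using a av_add_le_max[of "(u - 1) ^ p" "of_nat p * (u - 1) * g"] by simp
  then show ?thesis using g(2) by (simp add: unit_filt_iff)
qed

text \<open>Away from the index where \<open>p * i = i + e\<close>, exactly one of the terms \<open>x ^ p\<close> and \<open>p * x\<close>
  dominates, so the level of the power is exactly the shifted level.\<close>

lemma unit_filt_power_injective_generic:
  assumes i: "1 \<le> i" and u: "u \<in> unit_filt av i" and up: "u ^ p \<in> unit_filt av (Suc (shift i))"
    and generic: "av (of_nat p) * unif_abs ^ i \<noteq> unif_abs ^ (p * i)"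
  shows "u \<in> unit_filt av (Suc i)"
proof (rule ccontr)
  assume "u \<notin> unit_filt av (Suc i)"
  then have ex: "av (u - 1) = unif_abs ^ i" using unit_filt_exact[OF u] by blast
  obtain g where g: "av g = 1" "(1 + (u - 1)) ^ p = 1 + (u - 1) ^ p + of_nat p * (u - 1) * g"
    using one_plus_power_prime[OF p_prime unit_filt_av(3)[OF u i]] .
  have a: "av ((u - 1) ^ p) = unif_abs ^ (p * i)" by (simp add: av_power ex power_mult[symmetric] mult.commute)
  have b: "av (of_nat p * (u - 1) * g) = av (of_nat p) * unif_abs ^ i" by (simp add: av_mult g(1) ex)
  have "av (u ^ p - 1) = max (unif_abs ^ (p * i)) (av (of_nat p) * unif_abs ^ i)"
    using av_add_eq_max[of "(u - 1) ^ p" "of_nat p * (u - 1) * g"] generic a b g(2) by simp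
  also have "\<dots> \<ge> unif_abs ^ shift i"
  proof (cases rule: shift_cases)
    case 1 then show ?thesis by simp
  next
    case (2 e) then show ?thesis by (simp add: min_def power_add mult.commute max.coboundedI1 max.coboundedI2)
  qed
  finally have "unif_abs ^ shift i \<le> unif_abs ^ Suc (shift i)"
    using up unfolding unit_filt_iff by linarith
  then show False unfolding unif_abs_power_le_iff by simp
qed

text \<open>Every graded piece has as many elements as the residue field, so an injective map between two
  of them is surjective.\<close>

lemma unit_filt_power_surjective_if_injective:
  assumes i: "1 \<le> i"
    and inj: "\<And>u. u \<in> unit_filt av i \<Longrightarrow> u ^ p \<in> unit_filt av (Suc (shift i)) \<Longrightarrow> u \<in> unit_filt av (Suc i)"
    and v: "v \<in> unit_filt av (shift i)"
  obtains u where "u \<in> unit_filt av i" "v / u ^ p \<in> unit_filt av (Suc (shift i))"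
proof -
  obtain R where R: "finite R" "\<And>r. r \<in> R \<Longrightarrow> av r \<le> 1"
    "\<And>x. av x \<le> 1 \<Longrightarrow> \<exists>r\<in>R. av (x - r) < 1"
    "\<And>r s. r \<in> R \<Longrightarrow> s \<in> R \<Longrightarrow> av (r - s) < 1 \<Longrightarrow> r = s"
    by (rule finite_residue_system) blast
  obtain \<pi> where pi: "av \<pi> = unif_abs" by (rule uniformizer)
  have pi0: "\<pi> \<noteq> 0" using pi unif_abs_pos by auto
  have shift1: "1 \<le> shift i" using shift_gt[OF i] i by simp
  define w where "w = (\<lambda>r. 1 + r * \<pi> ^ i)"
  have w: "w r \<in> unit_filt av i" if "r \<in> R" for r
    using R(2)[OF that] unif_abs_pos
    by (simp add: w_def unit_filt_iff av_mult av_power pi mult_left_le_one_le av_nonneg)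
  have digit: "\<exists>s\<in>R. av (z - (1 + s * \<pi> ^ k)) \<le> unif_abs ^ Suc k" if "z \<in> unit_filt av k" for z k
    using unit_filt_digit[OF _ pi that, of R] R(3) by blast
  define f where "f = (\<lambda>r. SOME s. s \<in> R \<and> av (w r ^ p - (1 + s * \<pi> ^ shift i)) \<le> unif_abs ^ Suc (shift i))"
  have f: "f r \<in> R" "av (w r ^ p - (1 + f r * \<pi> ^ shift i)) \<le> unif_abs ^ Suc (shift i)" if "r \<in> R" for r
    using someI_ex[OF digit[OF unit_filt_power[OF w[OF that] i], unfolded Bex_def]] by (auto simp: f_def)
  have "inj_on f R"
  proof (rule inj_onI)
    fix r s assume rs: "r \<in> R" "s \<in> R" "f r = f s"
    have "av (w r ^ p - w s ^ p) \<le> unif_abs ^ Suc (shift i)"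
      using f(2)[OF rs(1)] f(2)[OF rs(2)] rs(3)
        av_diff_le_max[of "w r ^ p - (1 + f r * \<pi> ^ shift i)" "w s ^ p - (1 + f r * \<pi> ^ shift i)"] by simp
    then have "(w r / w s) ^ p \<in> unit_filt av (Suc (shift i))"
      using unit_filt_divide_iff[of "w s ^ p" "w r ^ p"] unit_filt_av(1)[OF w[OF rs(2)] i]
      by (simp add: av_power power_divide)
    then have "w r / w s \<in> unit_filt av (Suc i)"
      using inj[OF unit_filt_divide[OF w[OF rs(1)] w[OF rs(2)] i]] by blast
    then have "av (w r - w s) \<le> unif_abs ^ Suc i"
      using unit_filt_divide_iff[OF unit_filt_av(1)[OF w[OF rs(2)] i]] by blast
    moreover have "w r - w s = (r - s) * \<pi> ^ i" by (simp add: w_def algebra_simps)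
    ultimately have "av (r - s) \<le> unif_abs"
      using unif_abs_pos by (simp add: av_mult av_power pi)
    then show "r = s" using R(4)[OF rs(1,2)] unif_abs_less_1 by linarith
  qed
  then have surj: "f ` R = R" using R(1) f(1) by (intro endo_inj_surj) auto
  obtain s where s: "s \<in> R" "av (v - (1 + s * \<pi> ^ shift i)) \<le> unif_abs ^ Suc (shift i)"
    using digit[OF v] by blast
  have "s \<in> f ` R" using surj s(1) by simp
  then obtain r where r: "r \<in> R" "f r = s" by auto
  have "av (v - w r ^ p) \<le> unif_abs ^ Suc (shift i)"
    using s(2) f(2)[OF r(1)] r(2)
      av_diff_le_max[of "v - (1 + s * \<pi> ^ shift i)" "w r ^ p - (1 + s * \<pi> ^ shift i)"] by simp
  then have "v / w r ^ p \<in> unit_filt av (Suc (shift i))"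
    using unit_filt_divide_iff[of "w r ^ p" v] unit_filt_av(1)[OF w[OF r(1)] i] by (simp add: av_power)
  then show thesis using that w[OF r(1)] by blast
qed

end

locale local_field_no_p_torsion = local_field_residue_char +
  assumes mu_trivial: "mu p = {1 :: 'a}"
begin

text \<open>At the critical index \<open>p * i = i + e\<close>, a unit of exact level \<open>i\<close> whose \<open>p\<close>-th power is too
  close to 1 can be corrected by units of higher level, where taking \<open>p\<close>-th powers is surjective
  on graded pieces, to units whose \<open>p\<close>-th powers tend to 1. By compactness a limit exists: a
  \<open>p\<close>-th root of unity that still has exact level \<open>i\<close> and hence differs from 1.\<close>

lemma unit_filt_power_injective:
  assumes i: "1 \<le> i" and u: "u \<in> unit_filt av i" and up: "u ^ p \<in> unit_filt av (Suc (shift i))"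
  shows "u \<in> unit_filt av (Suc i)"
proof (cases "av (of_nat p) * unif_abs ^ i = unif_abs ^ (p * i)")
  case False
  then show ?thesis using unit_filt_power_injective_generic[OF i u up] by blast
next
  case critical: True
  have nz: "(of_nat p :: 'a) \<noteq> 0" using critical unif_abs_pos by auto
  obtain e where e: "1 \<le> e" "av (of_nat p) = unif_abs ^ e" "\<And>i. shift i = min (i + e) (p * i)"
    by (rule shift_char_0[OF nz]) blast
  have pow_eq: "unif_abs ^ m = unif_abs ^ n \<longleftrightarrow> m = n" for m n
    by (metis le_antisym order_refl unif_abs_power_le_iff)
  have pi_eq: "p * i = i + e"
    using critical pow_eq[of "e + i" "p * i"] by (simp add: e(2) power_add)
  have shift_high: "shift (Suc (i + n)) = Suc (shift i + n)" for n
  proof -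
    have "Suc (i + n) + e = p * i + 1 * Suc n" using pi_eq by simp
    also have "\<dots> \<le> p * i + p * Suc n"
      using prime_gt_0_nat[OF p_prime] by (intro add_left_mono mult_le_mono1) simp
    also have "\<dots> = p * Suc (i + n)" by (simp add: algebra_simps)
    finally have "Suc (i + n) + e \<le> p * Suc (i + n)" .
    then show ?thesis using pi_eq by (simp add: e(3))
  qed
  have generic: "av (of_nat p) * unif_abs ^ Suc (i + n) \<noteq> unif_abs ^ (p * Suc (i + n))" for n
  proof -
    have "e + Suc (i + n) < p * i + 2 * Suc n" using pi_eq by simp
    also have "\<dots> \<le> p * i + p * Suc n"
      using prime_ge_2_nat[OF p_prime] by (intro add_left_mono mult_le_mono1)
    also have "\<dots> = p * Suc (i + n)" by (simp add: algebra_simps)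
    finally have "e + Suc (i + n) < p * Suc (i + n)" .
    then show ?thesis unfolding e(2) power_add[symmetric] pow_eq by simp
  qed
  show ?thesis
  proof (rule ccontr)
    assume "u \<notin> unit_filt av (Suc i)"
    then have ex: "av (u - 1) = unif_abs ^ i" using unit_filt_exact[OF u] by blast
    have avu: "av u = 1" "u \<noteq> 0" using unit_filt_av[OF u i] by auto
    have "\<exists>w. av (w - u) \<le> unif_abs ^ Suc i \<and> w ^ p \<in> unit_filt av (Suc (shift i) + n)" for n
    proof (induction n)
      case 0
      then show ?case using up unif_abs_pos by (intro exI[of _ u]) simp
    next
      case (Suc n)
      then obtain w where w: "av (w - u) \<le> unif_abs ^ Suc i" "w ^ p \<in> unit_filt av (Suc (shift i) + n)"
        by blast
      have "w ^ p \<in> unit_filt av (shift (Suc (i + n)))" using w(2) by (simp add: shift_high)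
      then obtain s where s: "s \<in> unit_filt av (Suc (i + n))"
          "w ^ p / s ^ p \<in> unit_filt av (Suc (shift (Suc (i + n))))"
        using unit_filt_power_surjective_if_injective[of "Suc (i + n)" "w ^ p"]
          unit_filt_power_injective_generic[of "Suc (i + n)"] generic[of n] by (metis le_add1 plus_1_eq_Suc)
      have avs: "av s = 1" "s \<noteq> 0" using unit_filt_av[OF s(1)] by auto
      have "s \<in> unit_filt av (Suc i)" using s(1) unit_filt_antimono[of "Suc i" "Suc (i + n)"] by auto
      then have "av (u * (1 - s)) \<le> unif_abs ^ Suc i"
        using avu by (simp add: av_mult unit_filt_iff av_diff_commute)
      moreover have "w / s - u = (w - u + u * (1 - s)) / s" using avs by (simp add: field_simps)
      ultimately have "av (w / s - u) \<le> unif_abs ^ Suc i"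
        using w(1) av_add_le_max[of "w - u" "u * (1 - s)"] avs by (simp add: av_divide)
      then show ?case using s(2) shift_high[of n] by (intro exI[of _ "w / s"]) (simp add: power_divide)
    qed
    then obtain w where w: "\<And>n. av (w n - u) \<le> unif_abs ^ Suc i"
        "\<And>n. w n ^ p \<in> unit_filt av (Suc (shift i) + n)" by metis
    have small: "unif_abs ^ Suc i < 1"
      using unif_abs_pos unif_abs_less_1 by (intro power_Suc_less_one) auto
    have avw: "av (w n) \<le> 1" for n
      using av_add_le_max[of "w n - u" u] w(1)[of n] avu small by simp
    obtain l r where lr: "strict_mono (r :: nat \<Rightarrow> nat)" "(\<lambda>n. av (w (r n) - l)) \<longlonglongrightarrow> 0"
      using bounded_convergent_subsequence[of w 1] avw by metis
    have "\<forall>\<^sub>F n in sequentially. av (w (r n) - l) < unif_abs ^ Suc i"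
      using lr(2) unif_abs_pos by (intro order_tendstoD(2)) auto
    then obtain m where m: "av (w (r m) - l) < unif_abs ^ Suc i" unfolding eventually_sequentially by blast
    have lu: "av (l - u) \<le> unif_abs ^ Suc i"
      using av_diff_le_max[of "w (r m) - u" "w (r m) - l"] m w(1)[of "r m"] by simp
    have l1: "av l \<le> 1" using av_add_le_max[of "l - u" u] lu avu small by simp
    have power_diff: "av (x ^ k - y ^ k) \<le> av (x - y)" if "av x \<le> 1" "av y \<le> 1" for x y k
    proof -
      have "av (\<Sum>i<k. y ^ (k - Suc i) * x ^ i) \<le> 1"
        using that by (intro av_sum_le) (auto simp: av_mult av_power av_nonneg mult_le_one power_le_one)
      then show ?thesis
        unfolding power_diff_sumr2 av_mult using av_nonneg by (simp add: mult_left_le)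
    qed
    have "av (l ^ p - 1) \<le> 0 + 0"
    proof (rule LIMSEQ_le_const)
      show "(\<lambda>n. av (w (r n) - l) + unif_abs ^ n) \<longlonglongrightarrow> 0 + 0"
        using lr(2) unif_abs_pos unif_abs_less_1 by (intro tendsto_add LIMSEQ_realpow_zero) auto
      have "av (l ^ p - 1) \<le> av (w (r n) - l) + unif_abs ^ n" for n
      proof -
        have "av (w (r n) ^ p - 1) \<le> unif_abs ^ (Suc (shift i) + r n)" using w(2)[of "r n"] by (simp add: unit_filt_iff)
        also have "\<dots> \<le> unif_abs ^ n"
          unfolding unif_abs_power_le_iff using strict_mono_imp_increasing[OF lr(1), of n] by simp
        finally have a: "av (w (r n) ^ p - 1) \<le> unif_abs ^ n" .
        have "av (w (r n) ^ p - l ^ p) \<le> av (w (r n) - l)" using power_diff avw l1 by blast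
        then show ?thesis
          using a av_diff_le_max[of "w (r n) ^ p - 1" "w (r n) ^ p - l ^ p"]
            av_nonneg[of "w (r n) - l"] unif_abs_pos by (simp add: max_def split: if_splits) (smt (verit) zero_less_power)
      qed
      then show "\<exists>N. \<forall>n\<ge>N. av (l ^ p - 1) \<le> av (w (r n) - l) + unif_abs ^ n" by blast
    qed
    then have "l ^ p = 1" using av_pos[of "l ^ p - 1"] by force
    then have "l = 1" using mu_trivial by (auto simp: mu_def)
    then have "unif_abs ^ i \<le> unif_abs ^ Suc i" using lu ex by (simp add: av_diff_commute)
    then show False unfolding unif_abs_power_le_iff by simp
  qed
qed

lemma unit_filt_power_surjective:
  assumes "1 \<le> i" "v \<in> unit_filt av (shift i)"
  obtains u where "u \<in> unit_filt av i" "v / u ^ p \<in> unit_filt av (Suc (shift i))"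
  using unit_filt_power_surjective_if_injective[OF assms(1) unit_filt_power_injective[OF assms(1)] assms(2)] by blast

end

section \<open>Characters modulo p-adically integral rationals\<close>

text \<open>A map into \<open>\<rat>\<close> that is multiplicative-to-additive up to rationals of absolute value at
  most 1 represents a homomorphism into \<open>\<rat>\<^sub>p / \<int>\<^sub>p\<close>. Working with representatives keeps cosets out of
  the construction of characters.\<close>

definition char_mod :: "nat \<Rightarrow> ('a::field \<Rightarrow> rat) \<Rightarrow> 'a set \<Rightarrow> bool" where
  "char_mod p \<phi> S \<longleftrightarrow> (\<forall>x\<in>S. \<forall>y\<in>S. padic_abs p (\<phi> (x * y) - \<phi> x - \<phi> y) \<le> 1)"

definition mult_subgroup :: "'a::field set \<Rightarrow> bool" where
  "mult_subgroup S \<longleftrightarrow>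
     1 \<in> S \<and> 0 \<notin> S \<and> (\<forall>x\<in>S. \<forall>y\<in>S. x * y \<in> S) \<and> (\<forall>x\<in>S. inverse x \<in> S)"

lemma mult_subgroup_power: "mult_subgroup S \<Longrightarrow> x \<in> S \<Longrightarrow> x ^ n \<in> S"
  by (induction n) (auto simp: mult_subgroup_def)

lemma mult_subgroup_divide: "mult_subgroup S \<Longrightarrow> x \<in> S \<Longrightarrow> y \<in> S \<Longrightarrow> x / y \<in> S"
  by (auto simp: mult_subgroup_def divide_inverse)

lemma mult_subgroup_cancel:
  assumes "mult_subgroup S" "y \<in> S" "x * y \<in> S"
  shows "x \<in> S"
proof -
  have "y \<noteq> 0" using assms by (auto simp: mult_subgroup_def)
  then show ?thesis using mult_subgroup_divide[OF assms(1,3,2)] by simp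
qed

lemma padic_abs_le_add:
  assumes "prime p" "padic_abs p x \<le> B" "padic_abs p y \<le> B"
  shows "padic_abs p (x + y) \<le> B"
  using padic_abs_add[OF assms(1), of x y] assms by simp

lemma padic_abs_le_diff:
  assumes "prime p" "padic_abs p x \<le> B" "padic_abs p y \<le> B"
  shows "padic_abs p (x - y) \<le> B"
  using padic_abs_diff[OF assms(1), of x y] assms by simp

lemma padic_abs_of_nat_mult_le:
  assumes "prime p" "padic_abs p x \<le> B"
  shows "padic_abs p (of_nat n * x) \<le> B"
proof -
  have "padic_abs p (of_nat n) \<le> 1" using padic_abs_of_int_le_1[OF assms(1), of "int n"] by simp
  then have "padic_abs p (of_nat n) * padic_abs p x \<le> padic_abs p x"
    using padic_abs_nonneg by (simp add: mult_left_le_one_le)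
  then show ?thesis using assms padic_abs_mult[OF assms(1)] by simp
qed

lemma char_mod_one:
  assumes "char_mod p \<phi> S" "1 \<in> S" "prime p"
  shows "padic_abs p (\<phi> 1) \<le> 1"
proof -
  have "padic_abs p (\<phi> (1 * 1) - \<phi> 1 - \<phi> 1) \<le> 1" using assms unfolding char_mod_def by blast
  then show ?thesis using padic_abs_minus[OF assms(3), of "\<phi> 1"] by simp
qed

lemma char_mod_power:
  assumes c: "char_mod p \<phi> S" and S: "mult_subgroup S" and p: "prime p" and x: "x \<in> S"
  shows "padic_abs p (\<phi> (x ^ n) - of_nat n * \<phi> x) \<le> 1"
proof (induction n)
  case 0
  have "1 \<in> S" using S by (simp add: mult_subgroup_def)
  then show ?case using char_mod_one[OF c _ p] by simp
next
  case (Suc n)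
  have "padic_abs p (\<phi> (x * x ^ n) - \<phi> x - \<phi> (x ^ n)) \<le> 1"
    using c x mult_subgroup_power[OF S x] unfolding char_mod_def by blast
  from padic_abs_le_add[OF p this Suc] show ?case by (simp add: algebra_simps)
qed

text \<open>An element whose \<open>p\<close>-th power lies in a subgroup, but not the element itself, generates over
  it a cyclic extension of degree \<open>p\<close>, since \<open>p\<close> is prime.\<close>

lemma prime_dvd_if_power_in_subgroup:
  assumes p: "prime p" and S: "mult_subgroup S" and x: "x \<notin> S" "x ^ p \<in> S" and k: "x ^ k \<in> S"
  shows "p dvd k"
proof (rule ccontr)
  assume "\<not> p dvd k"
  then have "coprime k p" using p prime_imp_coprime coprime_commute by blast
  then obtain a where a: "[k * a = Suc 0] (mod p)" using cong_solve_coprime_nat[of k p] by auto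
  then have "k * a mod p = 1" using prime_gt_1_nat[OF p] by (simp add: cong_def)
  then have "k * a = Suc (p * (k * a div p))" using div_mult_mod_eq[of "k * a" p] by (simp add: mult.commute)
  then have "(x ^ k) ^ a = x * (x ^ p) ^ (k * a div p)" by (metis power_Suc power_mult)
  moreover have "(x ^ k) ^ a \<in> S" "(x ^ p) ^ (k * a div p) \<in> S"
    using mult_subgroup_power[OF S] k x(2) by auto
  ultimately show False using x(1) mult_subgroup_cancel[OF S] by metis
qed

text \<open>A character extends to a cyclic extension of degree \<open>p\<close>, with any value \<open>z\<close> at the generator
  that is compatible with its \<open>p\<close>-th power. The bound on a subgroup \<open>L\<close> that contains the new
  generator is inherited, because an element \<open>s * x ^ n\<close> lies in \<open>L\<close> only if \<open>s\<close> does.\<close>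

lemma char_mod_adjoin:
  assumes p: "prime p" and S: "mult_subgroup S" and L: "mult_subgroup L" and c: "char_mod p \<phi> S"
    and bound: "\<And>y. y \<in> S \<Longrightarrow> y \<in> L \<Longrightarrow> padic_abs p (\<phi> y) \<le> B" and B: "1 \<le> B"
    and x: "x \<in> L" "x \<notin> S" "x ^ p \<in> S"
    and z: "padic_abs p z \<le> B" "padic_abs p (of_nat p * z - \<phi> (x ^ p)) \<le> 1"
  shows "\<exists>\<phi>' S'. char_mod p \<phi>' S' \<and> mult_subgroup S' \<and> S \<subseteq> S' \<and> x \<in> S' \<and>
    (\<forall>y\<in>S. padic_abs p (\<phi>' y - \<phi> y) \<le> 1) \<and> padic_abs p (\<phi>' x - z) \<le> 1 \<and>
    (\<forall>y\<in>S' \<inter> L. padic_abs p (\<phi>' y) \<le> B)"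
proof -
  have x0: "x \<noteq> 0" using x(1) L by (auto simp: mult_subgroup_def)
  have S1: "1 \<in> S" using S by (simp add: mult_subgroup_def)
  define S' where "S' = {s * x ^ n | s n. s \<in> S}"
  define dec where "dec = (\<lambda>y. SOME sn. fst sn \<in> S \<and> y = fst sn * x ^ snd sn)"
  define \<phi>' where "\<phi>' = (\<lambda>y. \<phi> (fst (dec y)) + of_nat (snd (dec y)) * z)"
  \<comment> \<open>two decompositions differ by a power of \<open>x ^ p\<close>, for which the value \<open>z\<close> is compatible\<close>
  have ordered: "padic_abs p (\<phi> s + of_nat n * z - (\<phi> t + of_nat m * z)) \<le> 1"
    if st: "s \<in> S" "t \<in> S" "s * x ^ n = t * x ^ m" "n \<le> m" for s t n m
  proof -
    have "x ^ m = x ^ (m - n) * x ^ n" using st(4) by (simp flip: power_add)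
    then have s: "s = t * x ^ (m - n)" using st(3) x0 by simp
    then have "x ^ (m - n) \<in> S" using mult_subgroup_cancel[OF S st(2)] st(1) by (metis mult.commute)
    then obtain k where k: "m - n = p * k" using prime_dvd_if_power_in_subgroup[OF p S x(2,3)] by blast
    have a: "padic_abs p (\<phi> (t * (x ^ p) ^ k) - \<phi> t - \<phi> ((x ^ p) ^ k)) \<le> 1"
      using c st(2) mult_subgroup_power[OF S x(3)] unfolding char_mod_def by blast
    have b: "padic_abs p (\<phi> ((x ^ p) ^ k) - of_nat k * \<phi> (x ^ p)) \<le> 1"
      by (rule char_mod_power[OF c S p x(3)])
    have d: "padic_abs p (of_nat k * (of_nat p * z - \<phi> (x ^ p))) \<le> 1"
      using z(2) by (rule padic_abs_of_nat_mult_le[OF p])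
    have "(of_nat m :: rat) = of_nat n + of_nat p * of_nat k"
      using k st(4) by (metis add_diff_inverse_nat not_less of_nat_add of_nat_mult)
    then have eq: "\<phi> s + of_nat n * z - (\<phi> t + of_nat m * z)
        = (\<phi> (t * (x ^ p) ^ k) - \<phi> t - \<phi> ((x ^ p) ^ k)) + (\<phi> ((x ^ p) ^ k) - of_nat k * \<phi> (x ^ p))
          - of_nat k * (of_nat p * z - \<phi> (x ^ p))"
      unfolding s k power_mult by (simp add: algebra_simps)
    show ?thesis unfolding eq by (rule padic_abs_le_diff[OF p padic_abs_le_add[OF p a b] d])
  qed
  have val: "padic_abs p (\<phi>' (s * x ^ n) - (\<phi> s + of_nat n * z)) \<le> 1" if s: "s \<in> S" for s n
  proof -
    have "fst (s, n) \<in> S \<and> s * x ^ n = fst (s, n) * x ^ snd (s, n)" using s by simp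
    then have d: "fst (dec (s * x ^ n)) \<in> S \<and> s * x ^ n = fst (dec (s * x ^ n)) * x ^ snd (dec (s * x ^ n))"
      unfolding dec_def by (rule someI)
    show ?thesis
    proof (cases "snd (dec (s * x ^ n)) \<le> n")
      case True
      then show ?thesis unfolding \<phi>'_def using d s by (intro ordered) auto
    next
      case False
      then have "padic_abs p (\<phi> s + of_nat n * z - \<phi>' (s * x ^ n)) \<le> 1"
        unfolding \<phi>'_def using d s by (intro ordered) auto
      then show ?thesis by (simp add: padic_abs_minus_commute[OF p])
    qed
  qed
  have "char_mod p \<phi>' S'"
    unfolding char_mod_def
  proof (intro ballI)
    fix u v assume "u \<in> S'" "v \<in> S'"
    then obtain s n t m where u: "u = s * x ^ n" "s \<in> S" and v: "v = t * x ^ m" "t \<in> S"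
      by (auto simp: S'_def)
    have st: "s * t \<in> S" using u v S by (simp add: mult_subgroup_def)
    have uv: "u * v = (s * t) * x ^ (n + m)" using u v by (simp add: power_add)
    have a: "padic_abs p (\<phi> (s * t) - \<phi> s - \<phi> t) \<le> 1" using c u v unfolding char_mod_def by blast
    have eq: "\<phi>' (u * v) - \<phi>' u - \<phi>' v
        = (\<phi>' ((s * t) * x ^ (n + m)) - (\<phi> (s * t) + of_nat (n + m) * z)) + (\<phi> (s * t) - \<phi> s - \<phi> t)
          - (\<phi>' (s * x ^ n) - (\<phi> s + of_nat n * z)) - (\<phi>' (t * x ^ m) - (\<phi> t + of_nat m * z))"
      unfolding uv by (simp add: u v algebra_simps)
    show "padic_abs p (\<phi>' (u * v) - \<phi>' u - \<phi>' v) \<le> 1"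
      unfolding eq by (rule padic_abs_le_diff[OF p padic_abs_le_diff[OF p padic_abs_le_add[OF p val[OF st] a]
            val[OF u(2)]] val[OF v(2)]])
  qed
  moreover have "mult_subgroup S'"
    unfolding mult_subgroup_def
  proof (intro conjI ballI)
    show "1 \<in> S'" unfolding S'_def using S1 by (intro CollectI exI[of _ 1] exI[of _ 0]) auto
    show "0 \<notin> S'" using S x0 by (auto simp: S'_def mult_subgroup_def)
    fix u assume "u \<in> S'"
    then obtain s n where u: "u = s * x ^ n" "s \<in> S" by (auto simp: S'_def)
    have n: "n + (p - 1) * n = p * n" using prime_gt_0_nat[OF p] by (cases p) auto
    have "inverse u = inverse (s * (x ^ p) ^ n) * x ^ ((p - 1) * n)"
    proof -
      have Y: "s * (x ^ p) ^ n = u * x ^ ((p - 1) * n)"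
        unfolding u(1) mult.assoc power_add[symmetric] n by (simp only: power_mult)
      have "inverse a = inverse (a * b) * b" if "b \<noteq> 0" for a b :: 'a
        using that by (cases "a = 0") (auto simp: field_simps)
      then show ?thesis unfolding Y using x0 by simp
    qed
    moreover have "inverse (s * (x ^ p) ^ n) \<in> S"
      using S u(2) mult_subgroup_power[OF S x(3)] unfolding mult_subgroup_def by blast
    ultimately show "inverse u \<in> S'" unfolding S'_def by blast
    fix v assume "v \<in> S'"
    then obtain t m where v: "v = t * x ^ m" "t \<in> S" by (auto simp: S'_def)
    have "u * v = (s * t) * x ^ (n + m)" using u v by (simp add: power_add)
    moreover have "s * t \<in> S" using u v S by (simp add: mult_subgroup_def)
    ultimately show "u * v \<in> S'" unfolding S'_def by blast
  qed
  moreover have "S \<subseteq> S'"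
  proof
    fix s assume "s \<in> S"
    then show "s \<in> S'" unfolding S'_def by (intro CollectI exI[of _ s] exI[of _ 0]) auto
  qed
  moreover have "x \<in> S'" unfolding S'_def using S1 by (intro CollectI exI[of _ 1] exI[of _ 1]) auto
  moreover have "padic_abs p (\<phi>' y - \<phi> y) \<le> 1" if "y \<in> S" for y using val[OF that, of 0] by simp
  moreover have "padic_abs p (\<phi>' x - z) \<le> 1"
    using padic_abs_le_add[OF p val[OF S1, of 1] char_mod_one[OF c S1 p]] by simp
  moreover have "padic_abs p (\<phi>' y) \<le> B" if y: "y \<in> S'" "y \<in> L" for y
  proof -
    obtain s n where s: "y = s * x ^ n" "s \<in> S" using y by (auto simp: S'_def)
    have "s \<in> L" using mult_subgroup_cancel[OF L mult_subgroup_power[OF L x(1)]] y(2) s(1) by blast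
    then have a: "padic_abs p (\<phi> s + of_nat n * z) \<le> B"
      using bound[OF s(2)] padic_abs_of_nat_mult_le[OF p z(1)] by (intro padic_abs_le_add[OF p])
    have b: "padic_abs p (\<phi>' y - (\<phi> s + of_nat n * z)) \<le> B" using val[OF s(2), of n] s(1) B by simp
    show ?thesis using padic_abs_le_add[OF p b a] by simp
  qed
  ultimately show ?thesis by blast
qed

text \<open>Repeated extension. With coset representatives of \<open>S\<close> in a larger group for \<open>X\<close>, the new domain
  covers that group; the values at the generators are arbitrary \<open>p\<close>-th parts within the bound.\<close>

lemma char_mod_adjoin_finite:
  assumes p: "prime p" and L: "mult_subgroup L" and B: "1 \<le> B"
    and X: "finite X" "X \<subseteq> L"
    and S: "mult_subgroup S" and c: "char_mod p \<phi> S"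
    and bound: "\<And>y. y \<in> S \<Longrightarrow> y \<in> L \<Longrightarrow> padic_abs p (\<phi> y) \<le> B"
    and pow: "\<And>x. x \<in> L \<Longrightarrow> x ^ p \<in> S"
    and root: "\<And>x. x \<in> L \<Longrightarrow> \<exists>z. padic_abs p z \<le> B \<and> padic_abs p (of_nat p * z - \<phi> (x ^ p)) \<le> 1"
  shows "\<exists>S' \<phi>'. mult_subgroup S' \<and> S \<subseteq> S' \<and> X \<subseteq> S' \<and> char_mod p \<phi>' S' \<and>
    (\<forall>y\<in>S. padic_abs p (\<phi>' y - \<phi> y) \<le> 1) \<and> (\<forall>y\<in>S' \<inter> L. padic_abs p (\<phi>' y) \<le> B)"
  using X
proof (induction X rule: finite_induct)
  case empty
  show ?case using S c bound by (intro exI[of _ S] exI[of _ \<phi>]) auto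
next
  case (insert x X)
  then obtain S1 \<phi>1 where IH: "mult_subgroup S1" "S \<subseteq> S1" "X \<subseteq> S1" "char_mod p \<phi>1 S1"
    "\<And>y. y \<in> S \<Longrightarrow> padic_abs p (\<phi>1 y - \<phi> y) \<le> 1" "\<And>y. y \<in> S1 \<Longrightarrow> y \<in> L \<Longrightarrow> padic_abs p (\<phi>1 y) \<le> B"
    by auto
  have xL: "x \<in> L" using insert by auto
  show ?case
  proof (cases "x \<in> S1")
    case True
    then show ?thesis using IH by (intro exI[of _ S1] exI[of _ \<phi>1]) auto
  next
    case False
    obtain z where z: "padic_abs p z \<le> B" "padic_abs p (of_nat p * z - \<phi> (x ^ p)) \<le> 1"
      using root[OF xL] by blast
    have z': "padic_abs p (of_nat p * z - \<phi>1 (x ^ p)) \<le> 1"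
      using padic_abs_le_diff[OF p z(2) IH(5)[OF pow[OF xL]]] by (simp add: algebra_simps)
    have xp: "x ^ p \<in> S1" using pow[OF xL] IH(2) by blast
    obtain \<phi>2 S2 where "char_mod p \<phi>2 S2" "mult_subgroup S2" "S1 \<subseteq> S2" "x \<in> S2"
      and close: "\<And>y. y \<in> S1 \<Longrightarrow> padic_abs p (\<phi>2 y - \<phi>1 y) \<le> 1"
      and "\<And>y. y \<in> S2 \<inter> L \<Longrightarrow> padic_abs p (\<phi>2 y) \<le> B"
      using char_mod_adjoin[OF p IH(1) L IH(4) IH(6) B xL False xp z(1) z'] by metis
    moreover have "padic_abs p (\<phi>2 y - \<phi> y) \<le> 1" if "y \<in> S" for y
    proof -
      have "y \<in> S1" using that IH(2) by blast
      from padic_abs_le_add[OF p close[OF this] IH(5)[OF that]] show ?thesis by simp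
    qed
    ultimately show ?thesis using IH(2,3) by (intro exI[of _ S2] exI[of _ \<phi>2]) auto
  qed
qed

section \<open>Jumps of a character on a filtration shifted by p-th powers\<close>

text \<open>The properties of the unit groups of a local field without nontrivial \<open>p\<close>-th roots of unity from
  which the jump sets are determined. Index 0 is left out, as \<open>U 0\<close> may contain nonunits.\<close>

locale shifted_filtration =
  fixes U :: "nat \<Rightarrow> 'a::field set" and p :: nat and \<rho> :: "nat \<Rightarrow> nat"
  assumes p_prime: "prime p"
    and U_subgroup: "1 \<le> i \<Longrightarrow> mult_subgroup (U i)"
    and U_antimono: "1 \<le> i \<Longrightarrow> i \<le> j \<Longrightarrow> U j \<subseteq> U i"
    and U_proper: "1 \<le> i \<Longrightarrow> \<exists>x\<in>U i. x \<notin> U (Suc i)"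
    and U_finite_index: "1 \<le> i \<Longrightarrow> \<exists>F. finite F \<and> F \<subseteq> U i \<and> (\<forall>x\<in>U i. \<exists>y\<in>F. x / y \<in> U (Suc i))"
    and shift_mono: "i < j \<Longrightarrow> \<rho> i < \<rho> j"
    and shift_greater: "1 \<le> i \<Longrightarrow> i < \<rho> i"
    and U_power: "1 \<le> i \<Longrightarrow> u \<in> U i \<Longrightarrow> u ^ p \<in> U (\<rho> i)"
    and U_power_injective: "1 \<le> i \<Longrightarrow> u \<in> U i \<Longrightarrow> u ^ p \<in> U (Suc (\<rho> i)) \<Longrightarrow> u \<in> U (Suc i)"
    and U_power_surjective: "1 \<le> i \<Longrightarrow> v \<in> U (\<rho> i) \<Longrightarrow> \<exists>u\<in>U i. v / u ^ p \<in> U (Suc (\<rho> i))"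
begin

lemma U_mult: "1 \<le> i \<Longrightarrow> u \<in> U i \<Longrightarrow> v \<in> U i \<Longrightarrow> u * v \<in> U i"
  and U_one: "1 \<le> i \<Longrightarrow> 1 \<in> U i"
  and U_nonzero: "1 \<le> i \<Longrightarrow> u \<in> U i \<Longrightarrow> u \<noteq> 0"
  and U_inverse: "1 \<le> i \<Longrightarrow> u \<in> U i \<Longrightarrow> inverse u \<in> U i"
  using U_subgroup[of i] by (auto simp: mult_subgroup_def)

lemma shift_ge_1: "1 \<le> i \<Longrightarrow> 1 \<le> \<rho> i"
  using shift_greater[of i] by linarith

lemma Suc_shift_le: "Suc (\<rho> i) \<le> \<rho> (Suc i)"
  using shift_mono[of i "Suc i"] by simp

text \<open>The image of \<open>U i\<close> in \<open>\<rat>\<^sub>p / \<int>\<^sub>p\<close>, pulled back to a subgroup of \<open>\<rat>\<close>.\<close>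

definition vals :: "('a \<Rightarrow> rat) \<Rightarrow> nat \<Rightarrow> rat set" where
  "vals \<phi> i = {q. \<exists>u\<in>U i. padic_abs p (q - \<phi> u) \<le> 1}"

definition val_jumps :: "('a \<Rightarrow> rat) \<Rightarrow> nat set" where
  "val_jumps \<phi> = {i. 1 \<le> i \<and> vals \<phi> i \<noteq> vals \<phi> (Suc i)}"

lemma vals_value: "u \<in> U i \<Longrightarrow> \<phi> u \<in> vals \<phi> i"
  unfolding vals_def by (intro CollectI bexI[of _ u]) auto

lemma vals_antimono: "1 \<le> i \<Longrightarrow> i \<le> j \<Longrightarrow> vals \<phi> j \<subseteq> vals \<phi> i"
  using U_antimono[of i j] by (auto simp: vals_def)

context
  fixes \<phi>
  assumes char: "char_mod p \<phi> (U 1)"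
begin

lemma char_mult:
  assumes "1 \<le> i" "u \<in> U i" "v \<in> U i"
  shows "padic_abs p (\<phi> (u * v) - \<phi> u - \<phi> v) \<le> 1"
  using assms char U_antimono[of 1 i] unfolding char_mod_def by blast

lemma vals_integral:
  assumes "1 \<le> i" "padic_abs p q \<le> 1"
  shows "q \<in> vals \<phi> i"
proof -
  have "padic_abs p (\<phi> 1) \<le> 1" by (rule char_mod_one[OF char U_one p_prime]) simp
  then have "padic_abs p (q - \<phi> 1) \<le> 1" using padic_abs_le_diff[OF p_prime assms(2)] by blast
  then show ?thesis using U_one[OF assms(1)] by (auto simp: vals_def)
qed

lemma vals_add:
  assumes i: "1 \<le> i" and "q \<in> vals \<phi> i" "r \<in> vals \<phi> i"
  shows "q + r \<in> vals \<phi> i"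
proof -
  obtain u v where u: "u \<in> U i" "padic_abs p (q - \<phi> u) \<le> 1" and v: "v \<in> U i" "padic_abs p (r - \<phi> v) \<le> 1"
    using assms by (auto simp: vals_def)
  have eq: "q + r - \<phi> (u * v) = (q - \<phi> u) + (r - \<phi> v) - (\<phi> (u * v) - \<phi> u - \<phi> v)" by simp
  have "padic_abs p (q + r - \<phi> (u * v)) \<le> 1"
    unfolding eq by (rule padic_abs_le_diff[OF p_prime padic_abs_le_add[OF p_prime u(2) v(2)] char_mult[OF i u(1) v(1)]])
  then show ?thesis using U_mult[OF i u(1) v(1)] by (auto simp: vals_def)
qed

lemma vals_minus:
  assumes i: "1 \<le> i" and "q \<in> vals \<phi> i"
  shows "- q \<in> vals \<phi> i"
proof -
  obtain u where u: "u \<in> U i" "padic_abs p (q - \<phi> u) \<le> 1" using assms by (auto simp: vals_def)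
  have inv: "inverse u \<in> U i" using U_inverse[OF i u(1)] .
  have a: "padic_abs p (\<phi> 1) \<le> 1" by (rule char_mod_one[OF char U_one p_prime]) simp
  have b: "padic_abs p (\<phi> 1 - \<phi> u - \<phi> (inverse u)) \<le> 1"
    using char_mult[OF i u(1) inv] U_nonzero[OF i u(1)] by simp
  have eq: "- q - \<phi> (inverse u) = (\<phi> 1 - \<phi> u - \<phi> (inverse u)) - \<phi> 1 - (q - \<phi> u)" by simp
  have "padic_abs p (- q - \<phi> (inverse u)) \<le> 1"
    unfolding eq by (rule padic_abs_le_diff[OF p_prime padic_abs_le_diff[OF p_prime b a] u(2)])
  then show ?thesis using inv by (auto simp: vals_def)
qed

lemma vals_closed_downward:
  assumes "1 \<le> i" "q \<in> vals \<phi> i" "padic_abs p r \<le> padic_abs p q"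
  shows "r \<in> vals \<phi> i"
  using padic_subgroup_closed_downward[OF p_prime, of "vals \<phi> i" q r]
    vals_integral vals_add vals_minus assms by blast

lemma vals_power:
  assumes i: "1 \<le> i" and "q \<in> vals \<phi> i"
  shows "of_nat p * q \<in> vals \<phi> (\<rho> i)"
proof -
  obtain u where u: "u \<in> U i" "padic_abs p (q - \<phi> u) \<le> 1" using assms by (auto simp: vals_def)
  have u1: "u \<in> U 1" using u(1) U_antimono[of 1 i] i by auto
  have "padic_abs p (\<phi> (u ^ p) - of_nat p * \<phi> u) \<le> 1"
    by (rule char_mod_power[OF char U_subgroup p_prime u1]) simp
  from padic_abs_le_diff[OF p_prime padic_abs_of_nat_mult_le[OF p_prime u(2), of p] this]
  have "padic_abs p (of_nat p * q - \<phi> (u ^ p)) \<le> 1" by (simp add: algebra_simps)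
  then show ?thesis using U_power[OF i u(1)] by (auto simp: vals_def)
qed

text \<open>The value groups form a chain, so at a jump the absolute value of every value beyond it is
  at most \<open>1 / p\<close> times that of some value at its level.\<close>

lemma vals_jump_divide:
  assumes "i \<in> val_jumps \<phi>" "q \<in> vals \<phi> (Suc i)"
  shows "q / of_nat p \<in> vals \<phi> i"
proof -
  have i: "1 \<le> i" using assms by (simp add: val_jumps_def)
  then obtain r where r: "r \<in> vals \<phi> i" "r \<notin> vals \<phi> (Suc i)"
    using assms(1) vals_antimono[of i "Suc i" \<phi>] by (auto simp: val_jumps_def)
  have "padic_abs p q < padic_abs p r"
    using vals_closed_downward[of "Suc i" q r] assms(2) r(2) by force
  then have "padic_abs p (q / of_nat p) \<le> padic_abs p r"
    using padic_abs_less_imp[OF p_prime] by (simp add: padic_abs_divide_p[OF p_prime])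
  then show ?thesis using vals_closed_downward[OF i r(1)] by blast
qed

text \<open>Beyond a jump at \<open>a\<close> all values are \<open>p\<close>-multiples of values at level \<open>a\<close>, and these are
  attained at \<open>p\<close>-th powers, which lie at level \<open>\<rho> a\<close>. So the value groups are constant from \<open>a + 1\<close>
  to \<open>\<rho> a\<close>.\<close>

lemma val_jumps_gap:
  assumes "a \<in> val_jumps \<phi>" "b \<in> val_jumps \<phi>" "a < b"
  shows "\<rho> a \<le> b"
proof (rule ccontr)
  assume "\<not> \<rho> a \<le> b"
  have a: "1 \<le> a" and b: "1 \<le> b" using assms by (auto simp: val_jumps_def)
  have "vals \<phi> b \<subseteq> vals \<phi> (Suc b)"
  proof
    fix q assume "q \<in> vals \<phi> b"
    then have "q \<in> vals \<phi> (Suc a)" using vals_antimono[of "Suc a" b \<phi>] assms(3) by auto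
    then have "of_nat p * (q / of_nat p) \<in> vals \<phi> (\<rho> a)"
      by (intro vals_power a vals_jump_divide assms(1))
    moreover have "of_nat p * (q / of_nat p) = q" using prime_gt_0_nat[OF p_prime] by simp
    ultimately show "q \<in> vals \<phi> (Suc b)"
      using vals_antimono[of "Suc b" "\<rho> a" \<phi>] \<open>\<not> \<rho> a \<le> b\<close> by auto
  qed
  then have "vals \<phi> b = vals \<phi> (Suc b)" using vals_antimono[OF b, of "Suc b" \<phi>] by auto
  then show False using assms(2) by (simp add: val_jumps_def)
qed

text \<open>Every unit of level \<open>\<rho> i\<close> is a \<open>p\<close>-th power of a unit of level \<open>i\<close> up to higher level, so a
  jump at \<open>\<rho> i\<close> forces a jump at \<open>i\<close>.\<close>

lemma val_jumps_shift:
  assumes i: "1 \<le> i" and jump: "\<rho> i \<in> val_jumps \<phi>"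
  shows "i \<in> val_jumps \<phi>"
proof (rule ccontr)
  assume "i \<notin> val_jumps \<phi>"
  then have eq: "vals \<phi> i = vals \<phi> (Suc i)" using i by (simp add: val_jumps_def)
  let ?b = "Suc (\<rho> i)"
  have b: "1 \<le> ?b" by simp
  have "vals \<phi> (\<rho> i) \<subseteq> vals \<phi> ?b"
  proof
    fix q assume "q \<in> vals \<phi> (\<rho> i)"
    then obtain u where u: "u \<in> U (\<rho> i)" "padic_abs p (q - \<phi> u) \<le> 1" by (auto simp: vals_def)
    obtain y where y: "y \<in> U i" "u / y ^ p \<in> U ?b" using U_power_surjective[OF i u(1)] by blast
    have y1: "y \<in> U 1" using y(1) U_antimono[of 1 i] i by auto
    have yp: "y ^ p \<in> U (\<rho> i)" using U_power[OF i y(1)] .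
    have "\<phi> y \<in> vals \<phi> (Suc i)" unfolding eq[symmetric] by (rule vals_value[OF y(1)])
    then have "of_nat p * \<phi> y \<in> vals \<phi> (\<rho> (Suc i))" by (intro vals_power) auto
    then have a: "of_nat p * \<phi> y \<in> vals \<phi> ?b" using vals_antimono[OF b Suc_shift_le] by auto
    have c: "\<phi> (u / y ^ p) \<in> vals \<phi> ?b" by (rule vals_value[OF y(2)])
    have d: "padic_abs p (\<phi> (y ^ p) - of_nat p * \<phi> y) \<le> 1"
      by (rule char_mod_power[OF char U_subgroup p_prime y1]) simp
    have "u / y ^ p \<in> U (\<rho> i)" using y(2) U_antimono[OF shift_ge_1[OF i], of ?b] by auto
    then have e: "padic_abs p (\<phi> u - \<phi> (y ^ p) - \<phi> (u / y ^ p)) \<le> 1"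
      using char_mult[OF shift_ge_1[OF i] yp] U_nonzero[OF shift_ge_1[OF i] yp] by fastforce
    have "(q - \<phi> u) + (\<phi> u - \<phi> (y ^ p) - \<phi> (u / y ^ p)) + (\<phi> (y ^ p) - of_nat p * \<phi> y) \<in> vals \<phi> ?b"
      by (intro vals_integral[OF b] padic_abs_le_add[OF p_prime] u(2) d e)
    from vals_add[OF b vals_add[OF b this a] c] show "q \<in> vals \<phi> ?b" by simp
  qed
  then have "vals \<phi> (\<rho> i) = vals \<phi> ?b" using vals_antimono[OF shift_ge_1[OF i], of ?b \<phi>] by auto
  then show False using jump by (simp add: val_jumps_def)
qed

text \<open>A continuous character is trivial on some \<open>U N\<close>, which makes its jumps finite in number.\<close>

theorem val_jumps_in_Jump:
  assumes N: "1 \<le> N" "\<And>u. u \<in> U N \<Longrightarrow> padic_abs p (\<phi> u) \<le> 1"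
  shows "val_jumps \<phi> \<in> Jump \<rho>"
proof -
  have trivial: "vals \<phi> i = {q. padic_abs p q \<le> 1}" if "N \<le> i" for i
  proof (intro equalityI subsetI)
    fix q assume "q \<in> vals \<phi> i"
    then obtain u where u: "u \<in> U i" "padic_abs p (q - \<phi> u) \<le> 1" by (auto simp: vals_def)
    have "padic_abs p (\<phi> u) \<le> 1" using N(2) u(1) U_antimono[OF N(1) that] by blast
    from padic_abs_le_add[OF p_prime u(2) this] show "q \<in> {q. padic_abs p q \<le> 1}" by simp
  qed (use vals_integral N(1) that in auto)
  have "val_jumps \<phi> \<subseteq> {..<N}"
  proof
    fix i assume "i \<in> val_jumps \<phi>"
    then show "i \<in> {..<N}" using trivial[of i] trivial[of "Suc i"] by (force simp: val_jumps_def)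
  qed
  then have "finite (val_jumps \<phi>)" by (rule finite_subset) simp
  moreover have "val_jumps \<phi> \<subseteq> {1..}" by (auto simp: val_jumps_def)
  moreover have "val_jumps \<phi> - \<rho> ` val_jumps \<phi> \<subseteq> T_set \<rho>"
    using val_jumps_shift by (auto simp: T_set_def val_jumps_def)
  ultimately show ?thesis using val_jumps_gap by (simp add: Jump_def)
qed

end

section \<open>Iterated p-th powers\<close>

lemma iterated_shift_ge_1: "1 \<le> i \<Longrightarrow> 1 \<le> (\<rho> ^^ n) i"
  by (induction n) (auto intro: shift_ge_1[unfolded One_nat_def])

lemma inj_iterated_shift: "inj (\<rho> ^^ n)"
proof -
  have "inj \<rho>" by (rule injI) (metis shift_mono linorder_neqE_nat less_irrefl)
  then show ?thesis by (rule inj_fn)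
qed

lemma Suc_iterated_shift_le: "Suc ((\<rho> ^^ n) i) \<le> (\<rho> ^^ n) (Suc i)"
proof (induction n)
  case (Suc n)
  then show ?case using shift_mono[of "(\<rho> ^^ n) i" "(\<rho> ^^ n) (Suc i)"] by simp
qed simp

lemma iterated_shift_decomposition:
  assumes "1 \<le> i"
  obtains j k where "j \<in> T_set \<rho>" "i = (\<rho> ^^ k) j"
  using assms
proof (induction i arbitrary: thesis rule: less_induct)
  case (less i)
  show ?case
  proof (cases "i \<in> T_set \<rho>")
    case True
    then show ?thesis using less.prems(1)[of i 0] by simp
  next
    case False
    then obtain i' where i': "1 \<le> i'" "i = \<rho> i'" using less.prems(2) by (auto simp: T_set_def)
    obtain j k where "j \<in> T_set \<rho>" "i' = (\<rho> ^^ k) j"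
      using less.IH[of i'] shift_greater[OF i'(1)] i' by metis
    then show ?thesis using less.prems(1)[of j "Suc k"] i'(2) by simp
  qed
qed

lemma iterated_shift_unique:
  assumes j: "j \<in> T_set \<rho>" and j': "1 \<le> j'" and eq: "(\<rho> ^^ n) j' = (\<rho> ^^ k) j"
  shows "n \<le> k \<and> j' = (\<rho> ^^ (k - n)) j"
proof (cases "n \<le> k")
  case True
  then have "(\<rho> ^^ n) j' = (\<rho> ^^ n) ((\<rho> ^^ (k - n)) j)"
    using eq funpow_add[of n "k - n" \<rho>] by simp
  then show ?thesis using True inj_iterated_shift by (simp add: inj_eq)
next
  case False
  then obtain m where m: "n = k + Suc m" by (metis add_Suc_right less_imp_Suc_add not_le)
  have "(\<rho> ^^ k) ((\<rho> ^^ Suc m) j') = (\<rho> ^^ k) j"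
    using eq unfolding m funpow_add by simp
  then have "\<rho> ((\<rho> ^^ m) j') = j" using inj_iterated_shift by (simp add: inj_eq)
  then show ?thesis using j iterated_shift_ge_1[OF j', of m] by (auto simp: T_set_def)
qed

lemma U_iterated_power: "1 \<le> i \<Longrightarrow> u \<in> U i \<Longrightarrow> u ^ (p ^ n) \<in> U ((\<rho> ^^ n) i)"
proof (induction n)
  case (Suc n)
  then have "(u ^ (p ^ n)) ^ p \<in> U (\<rho> ((\<rho> ^^ n) i))" by (intro U_power iterated_shift_ge_1) auto
  then show ?case by (simp add: power_mult[symmetric] mult.commute)
qed simp

lemma U_iterated_power_injective:
  "1 \<le> i \<Longrightarrow> u \<in> U i \<Longrightarrow> u ^ (p ^ n) \<in> U (Suc ((\<rho> ^^ n) i)) \<Longrightarrow> u \<in> U (Suc i)"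
proof (induction n)
  case (Suc n)
  have "u ^ (p ^ n) \<in> U (Suc ((\<rho> ^^ n) i))"
  proof (rule U_power_injective)
    show "1 \<le> (\<rho> ^^ n) i" "u ^ (p ^ n) \<in> U ((\<rho> ^^ n) i)"
      using iterated_shift_ge_1 U_iterated_power Suc by auto
    show "(u ^ (p ^ n)) ^ p \<in> U (Suc (\<rho> ((\<rho> ^^ n) i)))"
      using Suc.prems(3) by (simp add: power_mult[symmetric] mult.commute)
  qed
  then show ?case using Suc by blast
qed simp

lemma U_iterated_power_surjective:
  "1 \<le> i \<Longrightarrow> v \<in> U ((\<rho> ^^ n) i) \<Longrightarrow> \<exists>u\<in>U i. v / u ^ (p ^ n) \<in> U (Suc ((\<rho> ^^ n) i))"
proof (induction n arbitrary: v)
  case 0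
  have "v \<noteq> 0" using U_nonzero[OF 0(1)] 0(2) by simp
  then show ?case using 0 U_one[of "Suc i"] by (intro bexI[of _ v]) auto
next
  case (Suc n)
  let ?m = "(\<rho> ^^ n) i"
  have m: "1 \<le> ?m" by (rule iterated_shift_ge_1[OF Suc.prems(1)])
  obtain u where u: "u \<in> U ?m" "v / u ^ p \<in> U (Suc (\<rho> ?m))"
    using U_power_surjective[OF m, of v] Suc.prems(2) by auto
  obtain y where y: "y \<in> U i" "u / y ^ (p ^ n) \<in> U (Suc ?m)" using Suc.IH[OF Suc.prems(1) u(1)] by blast
  have "(u / y ^ (p ^ n)) ^ p \<in> U (\<rho> (Suc ?m))" using y(2) by (intro U_power) auto
  then have "(u / y ^ (p ^ n)) ^ p \<in> U (Suc (\<rho> ?m))"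
    using U_antimono[of "Suc (\<rho> ?m)" "\<rho> (Suc ?m)"] Suc_shift_le[of ?m] by auto
  then have "v / u ^ p * (u / y ^ (p ^ n)) ^ p \<in> U (Suc (\<rho> ?m))" using u(2) by (intro U_mult) auto
  moreover have "v / u ^ p * (u / y ^ (p ^ n)) ^ p = v / y ^ (p ^ Suc n)"
    using U_nonzero[OF m u(1)] by (simp add: power_divide power_mult[symmetric] mult.commute)
  ultimately show ?case using y(1) by auto
qed

end

section \<open>Counting elements of a jump set\<close>

definition count_from :: "nat set \<Rightarrow> nat \<Rightarrow> nat" where
  "count_from A i = card {a \<in> A. i \<le> a}"

context shifted_filtration
begin

context
  fixes A
  assumes A: "A \<in> Jump \<rho>"
begin

lemma Jump_finite: "finite A" and Jump_ge_1: "a \<in> A \<Longrightarrow> 1 \<le> a"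
  and Jump_gap: "a \<in> A \<Longrightarrow> b \<in> A \<Longrightarrow> a < b \<Longrightarrow> \<rho> a \<le> b"
  and Jump_start: "a \<in> A \<Longrightarrow> a \<notin> \<rho> ` A \<Longrightarrow> a \<in> T_set \<rho>"
  using A by (auto simp: Jump_def)

lemma count_from_antimono: "i \<le> j \<Longrightarrow> count_from A j \<le> count_from A i"
  unfolding count_from_def using Jump_finite by (intro card_mono) auto

lemma count_from_le_card: "count_from A i \<le> card A"
  unfolding count_from_def using Jump_finite by (intro card_mono) auto

lemma count_from_Suc: "count_from A i = count_from A (Suc i) + (if i \<in> A then 1 else 0)"
proof (cases "i \<in> A")
  case True
  then have "{a \<in> A. i \<le> a} = insert i {a \<in> A. Suc i \<le> a}" by auto
  then show ?thesis using True Jump_finite by (simp add: count_from_def)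
next
  case False
  then have "{a \<in> A. i \<le> a} = {a \<in> A. Suc i \<le> a}" by (auto simp: Suc_le_eq order_le_less)
  then show ?thesis using False by (simp add: count_from_def)
qed

text \<open>Two elements of the window from \<open>i\<close> to \<open>\<rho> i\<close> would violate the gap condition, so the window
  contains at most one.\<close>

lemma count_from_shift_le:
  assumes "1 \<le> i"
  shows "count_from A i \<le> Suc (count_from A (\<rho> i))"
proof -
  have "a = b" if ab: "a \<in> A" "b \<in> A" "i \<le> a" "a < \<rho> i" "i \<le> b" "b < \<rho> i" for a b
  proof (rule ccontr)
    assume "a \<noteq> b"
    moreover have "\<not> c < d" if "c \<in> A" "d \<in> A" "i \<le> c" "d < \<rho> i" for c d
    proof
      assume "c < d"
      then have "\<rho> c \<le> d" using Jump_gap that by blast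
      moreover have "\<rho> i \<le> \<rho> c" using shift_mono[of i c] that(3) by (cases "i = c") auto
      ultimately show False using that(4) by simp
    qed
    ultimately show False using ab by (metis linorder_neqE_nat)
  qed
  moreover have "finite {a \<in> A. i \<le> a \<and> a < \<rho> i}" using Jump_finite by simp
  ultimately have "card {a \<in> A. i \<le> a \<and> a < \<rho> i} \<le> Suc 0"
    by (subst card_le_Suc0_iff_eq) auto
  moreover have "{a \<in> A. i \<le> a} \<subseteq> {a \<in> A. i \<le> a \<and> a < \<rho> i} \<union> {a \<in> A. \<rho> i \<le> a}" by auto
  then have "card {a \<in> A. i \<le> a} \<le> card ({a \<in> A. i \<le> a \<and> a < \<rho> i} \<union> {a \<in> A. \<rho> i \<le> a})"
    using Jump_finite by (intro card_mono) auto
  then have "card {a \<in> A. i \<le> a} \<le> card {a \<in> A. i \<le> a \<and> a < \<rho> i} + card {a \<in> A. \<rho> i \<le> a}"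
    using card_Un_le le_trans by blast
  ultimately show ?thesis by (simp add: count_from_def)
qed

lemma count_from_iterated_shift_le:
  assumes "1 \<le> i"
  shows "count_from A i \<le> count_from A ((\<rho> ^^ n) i) + n"
proof (induction n)
  case (Suc n)
  then show ?case using count_from_shift_le[OF iterated_shift_ge_1[OF assms, of n]] by simp
qed simp

lemma count_from_jump:
  assumes "a \<in> A"
  shows "count_from A a = Suc (count_from A (\<rho> a))"
proof -
  have "{b \<in> A. Suc a \<le> b} = {b \<in> A. \<rho> a \<le> b}"
    using Jump_gap[OF assms] shift_greater[OF Jump_ge_1[OF assms]] by auto
  then have "count_from A (Suc a) = count_from A (\<rho> a)" by (simp add: count_from_def)
  then show ?thesis using count_from_Suc[of a] assms by simp
qed

text \<open>An element in the range of \<open>\<rho>\<close> is the shift of another element, so a jump set is a union of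
  chains \<open>t, \<rho> t, \<rho> (\<rho> t), \<dots>\<close> that start outside the range of \<open>\<rho>\<close>.\<close>

lemma Jump_chain:
  assumes "a \<in> A"
  obtains t k where "t \<in> A" "t \<in> T_set \<rho>" "a = (\<rho> ^^ k) t" "count_from A t = count_from A a + k"
  using assms
proof (induction a arbitrary: thesis rule: less_induct)
  case (less a)
  show ?case
  proof (cases "a \<in> \<rho> ` A")
    case False
    then show ?thesis using less.prems(1)[of a 0] less.prems(2) Jump_start[of a] by simp
  next
    case True
    then obtain b where b: "b \<in> A" "a = \<rho> b" by auto
    obtain t k where "t \<in> A" "t \<in> T_set \<rho>" "b = (\<rho> ^^ k) t" "count_from A t = count_from A b + k"
      using less.IH[of b] shift_greater[OF Jump_ge_1[OF b(1)]] b by metis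
    then show ?thesis using less.prems(1)[of t "Suc k"] b(2) count_from_jump[OF b(1)] by simp
  qed
qed

end


section \<open>Realising a jump set by a character\<close>

text \<open>The character is built by descending induction on the level. The bound on \<open>p ^ n\<close>-th powers
  in this invariant anticipates the levels still to come: it ensures that the values at \<open>p\<close>-th
  powers of the elements to be adjoined admit \<open>p\<close>-th parts of the right size. Together with it, the
  lower bound fixes the order of the values along the chains of the jump set, where \<open>g j\<close> is a unit of exact level \<open>j\<close>.\<close>

definition adapted :: "nat set \<Rightarrow> (nat \<Rightarrow> 'a) \<Rightarrow> nat \<Rightarrow> ('a \<Rightarrow> rat) \<Rightarrow> bool" where
  "adapted A g i \<phi> \<longleftrightarrow> char_mod p \<phi> (U i) \<and>
     (\<forall>j n y. 1 \<le> j \<longrightarrow> i \<le> (\<rho> ^^ n) j \<longrightarrow> y \<in> U j \<longrightarrow>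
        padic_abs p (\<phi> (y ^ (p ^ n))) \<le> real p ^ (count_from A j - n)) \<and>
     (\<forall>j n. j \<in> A \<longrightarrow> j \<in> T_set \<rho> \<longrightarrow> n < count_from A j \<longrightarrow> i \<le> (\<rho> ^^ n) j \<longrightarrow>
        real p ^ (count_from A j - n) \<le> padic_abs p (\<phi> (g j ^ (p ^ n))))"

lemma padic_abs_ge_if_close:
  assumes "padic_abs p (x - z) \<le> 1" "B \<le> padic_abs p z" "1 < B"
  shows "B \<le> padic_abs p x"
  using padic_abs_diff[OF p_prime, of x "x - z"] assms by (simp add: max_def split: if_splits)

lemma padic_abs_le_if_close:
  assumes "padic_abs p (x - z) \<le> 1" "padic_abs p z \<le> B" "1 \<le> B"
  shows "padic_abs p x \<le> B"
  using padic_abs_add[OF p_prime, of "x - z" z] assms by (simp add: max_def split: if_splits)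

text \<open>The new level is \<open>i = (\<rho> ^^ k) j\<close> with \<open>j\<close> outside the range of \<open>\<rho>\<close>, and \<open>p ^ k\<close>-th powers from
  \<open>U j\<close> represent all cosets of \<open>U (i + 1)\<close> in \<open>U i\<close>. Their own \<open>p\<close>-th powers lie beyond \<open>i\<close>, where
  the invariant bounds the values by \<open>p ^ (c j - k - 1)\<close>; hence values bounded by \<open>p ^ (c j - k)\<close> can
  be chosen, where \<open>c = count_from A\<close>. Any other \<open>p ^ n\<close>-th power at level \<open>i\<close> splits into such a
  \<open>p ^ k\<close>-th power and a factor beyond \<open>i\<close>, so the bounds persist because \<open>c\<close> drops by at most 1
  under each application of \<open>\<rho>\<close>.\<close>

lemma adapted_step:
  assumes A: "A \<in> Jump \<rho>" and i: "1 \<le> i" and ad: "adapted A g (Suc i) \<phi>"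
    and g: "\<And>j. 1 \<le> j \<Longrightarrow> g j \<in> U j" "\<And>j. 1 \<le> j \<Longrightarrow> g j \<notin> U (Suc j)"
  shows "\<exists>\<phi>'. adapted A g i \<phi>'"
proof -
  let ?c = "count_from A"
  have p1: "1 < real p" using prime_gt_1_nat[OF p_prime] by simp
  have p_pow: "1 \<le> real p ^ n" for n using p1 by simp
  have p_pow_mono: "m \<le> n \<Longrightarrow> real p ^ m \<le> real p ^ n" for m n using p1 by (intro power_increasing) auto
  have ad_char: "char_mod p \<phi> (U (Suc i))" using ad by (simp add: adapted_def)
  have ad_le: "padic_abs p (\<phi> (y ^ (p ^ n))) \<le> real p ^ (?c j - n)"
    if "1 \<le> j" "Suc i \<le> (\<rho> ^^ n) j" "y \<in> U j" for j n y using ad that unfolding adapted_def by blast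
  have ad_ge: "real p ^ (?c j - n) \<le> padic_abs p (\<phi> (g j ^ (p ^ n)))"
    if "j \<in> A" "j \<in> T_set \<rho>" "n < ?c j" "Suc i \<le> (\<rho> ^^ n) j" for j n
    using ad that unfolding adapted_def by blast
  obtain j k where j: "j \<in> T_set \<rho>" and ijk: "i = (\<rho> ^^ k) j" using iterated_shift_decomposition[OF i] .
  have j1: "1 \<le> j" using j by (simp add: T_set_def)
  define H where "H = U (Suc i)"
  define L where "L = (\<lambda>y. y ^ (p ^ k)) ` U j"
  define B where "B = real p ^ (?c j - k)"
  have H: "mult_subgroup H" unfolding H_def by (rule U_subgroup) simp
  have L: "mult_subgroup L"
    unfolding mult_subgroup_def
  proof (intro conjI ballI)
    show "1 \<in> L" unfolding L_def by (rule image_eqI[of _ _ 1]) (auto simp: U_one[OF j1, unfolded One_nat_def] U_one[OF j1])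
    show "0 \<notin> L" unfolding L_def using U_nonzero[OF j1] by auto
    fix x assume "x \<in> L"
    then obtain a where a: "a \<in> U j" "x = a ^ (p ^ k)" by (auto simp: L_def)
    show "inverse x \<in> L"
      unfolding L_def using U_inverse[OF j1 a(1)] a(2) by (intro image_eqI[of _ _ "inverse a"]) (simp_all add: power_inverse)
    fix y assume "y \<in> L"
    then obtain b where b: "b \<in> U j" "y = b ^ (p ^ k)" by (auto simp: L_def)
    show "x * y \<in> L"
      unfolding L_def using U_mult[OF j1 a(1) b(1)] a(2) b(2)
      by (intro image_eqI[of _ _ "a * b"]) (simp_all add: power_mult_distrib)
  qed
  have B1: "1 \<le> B" unfolding B_def by (rule p_pow)
  have above: "Suc i \<le> (\<rho> ^^ Suc k) j" using shift_greater[OF i] ijk by simp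
  have pow: "x ^ p \<in> H" if x: "x \<in> L" for x
  proof -
    obtain y where y: "y \<in> U j" "x = y ^ (p ^ k)" using x by (auto simp: L_def)
    have "x ^ p = y ^ (p ^ Suc k)" using y(2) by (simp add: power_mult[symmetric] mult.commute)
    then have "x ^ p \<in> U ((\<rho> ^^ Suc k) j)" using U_iterated_power[OF j1 y(1), of "Suc k"] by simp
    then show ?thesis unfolding H_def using U_antimono[OF _ above] by auto
  qed
  have pow_le: "padic_abs p (\<phi> (x ^ p)) \<le> real p ^ (?c j - Suc k)" if x: "x \<in> L" for x
  proof -
    obtain y where y: "y \<in> U j" "x = y ^ (p ^ k)" using x by (auto simp: L_def)
    have "x ^ p = y ^ (p ^ Suc k)" using y(2) by (simp add: power_mult[symmetric] mult.commute)
    then show ?thesis using ad_le[OF j1 above y(1)] by simp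
  qed
  have bound: "padic_abs p (\<phi> x) \<le> B" if x: "x \<in> H" "x \<in> L" for x
  proof -
    obtain y where y: "y \<in> U j" "x = y ^ (p ^ k)" using x by (auto simp: L_def)
    have "y \<in> U (Suc j)" using U_iterated_power_injective[OF j1 y(1), of k] x(1) y(2) ijk by (simp add: H_def)
    then have "padic_abs p (\<phi> x) \<le> real p ^ (?c (Suc j) - k)"
      unfolding y(2) using Suc_iterated_shift_le[of k j] ijk by (intro ad_le) auto
    also have "\<dots> \<le> B"
      unfolding B_def using count_from_antimono[OF A, of j "Suc j"] by (intro p_pow_mono) auto
    finally show ?thesis .
  qed
  \<comment> \<open>first the value at the chosen generator of the chain, which has to have exact size \<open>B\<close>\<close>
  have special: "\<exists>\<phi>1 S1. char_mod p \<phi>1 S1 \<and> mult_subgroup S1 \<and> H \<subseteq> S1 \<and>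
      (\<forall>y\<in>H. padic_abs p (\<phi>1 y - \<phi> y) \<le> 1) \<and> (\<forall>y\<in>S1 \<inter> L. padic_abs p (\<phi>1 y) \<le> B) \<and>
      (j \<in> A \<longrightarrow> k < ?c j \<longrightarrow> g j ^ (p ^ k) \<in> S1 \<and> B \<le> padic_abs p (\<phi>1 (g j ^ (p ^ k))))"
  proof (cases "j \<in> A \<and> k < ?c j")
    case False
    then show ?thesis using ad_char H bound unfolding H_def by (intro exI[of _ \<phi>] exI[of _ "U (Suc i)"]) auto
  next
    case True
    define x where "x = g j ^ (p ^ k)"
    have x: "x \<in> L" unfolding x_def L_def using g(1)[OF j1] by blast
    have xH: "x \<notin> H"
      using U_iterated_power_injective[OF j1 g(1)[OF j1], of k] g(2)[OF j1] ijk by (auto simp: H_def x_def)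
    have BB: "B = real p * real p ^ (?c j - Suc k)"
      using True by (simp add: B_def power_Suc[symmetric] Suc_diff_Suc del: power_Suc)
    have "\<exists>z. padic_abs p z = B \<and> padic_abs p (of_nat p * z - \<phi> (x ^ p)) \<le> 1"
    proof (cases "Suc k < ?c j")
      case more: True
      have "x ^ p = g j ^ (p ^ Suc k)" by (simp add: x_def power_mult[symmetric] mult.commute)
      then have "real p ^ (?c j - Suc k) \<le> padic_abs p (\<phi> (x ^ p))"
        using ad_ge[of j "Suc k"] True more j above by simp
      then have "padic_abs p (\<phi> (x ^ p)) = real p ^ (?c j - Suc k)" using pow_le[OF x] by simp
      then show ?thesis
        using prime_gt_0_nat[OF p_prime] BB
        by (intro exI[of _ "\<phi> (x ^ p) / of_nat p"]) (simp add: padic_abs_divide_p[OF p_prime])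
    next
      case False
      then have zero: "?c j - Suc k = 0" by simp
      then have "padic_abs p (\<phi> (x ^ p)) \<le> 1" using pow_le[OF x] by simp
      then have "padic_abs p (1 - \<phi> (x ^ p)) \<le> 1"
        using padic_abs_le_diff[OF p_prime] padic_abs_1[OF p_prime] by simp
      then show ?thesis
        using prime_gt_0_nat[OF p_prime] BB zero padic_abs_divide_p[OF p_prime, of 1] padic_abs_1[OF p_prime]
        by (intro exI[of _ "1 / of_nat p"]) simp
    qed
    then obtain z where z: "padic_abs p z = B" "padic_abs p (of_nat p * z - \<phi> (x ^ p)) \<le> 1" by blast
    have Bgt: "1 < B" using True p1 by (simp add: B_def)
    obtain \<phi>1 S1 where S1: "char_mod p \<phi>1 S1" "mult_subgroup S1" "H \<subseteq> S1" "x \<in> S1"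
      "\<forall>y\<in>H. padic_abs p (\<phi>1 y - \<phi> y) \<le> 1" "padic_abs p (\<phi>1 x - z) \<le> 1"
      "\<forall>y\<in>S1 \<inter> L. padic_abs p (\<phi>1 y) \<le> B"
      using char_mod_adjoin[OF p_prime H L ad_char[folded H_def] bound B1 x xH pow[OF x] eq_refl[OF z(1)] z(2)]
      by metis
    then have "B \<le> padic_abs p (\<phi>1 x)" using padic_abs_ge_if_close[OF S1(6) _ Bgt] z(1) by simp
    then show ?thesis using S1 unfolding x_def by blast
  qed
  then obtain \<phi>1 S1 where S1: "char_mod p \<phi>1 S1" "mult_subgroup S1" "H \<subseteq> S1"
      and close1: "\<And>y. y \<in> H \<Longrightarrow> padic_abs p (\<phi>1 y - \<phi> y) \<le> 1"
      and bound1: "\<And>y. y \<in> S1 \<Longrightarrow> y \<in> L \<Longrightarrow> padic_abs p (\<phi>1 y) \<le> B"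
      and ge1: "j \<in> A \<Longrightarrow> k < ?c j \<Longrightarrow> g j ^ (p ^ k) \<in> S1"
        "j \<in> A \<Longrightarrow> k < ?c j \<Longrightarrow> B \<le> padic_abs p (\<phi>1 (g j ^ (p ^ k)))"
    by (metis IntI)
  have root: "\<exists>z. padic_abs p z \<le> B \<and> padic_abs p (of_nat p * z - \<phi>1 (x ^ p)) \<le> 1" if x: "x \<in> L" for x
  proof -
    have le: "padic_abs p (\<phi>1 (x ^ p)) \<le> real p ^ (?c j - Suc k)"
      using padic_abs_le_if_close[OF close1[OF pow[OF x]] pow_le[OF x] p_pow] .
    show ?thesis
    proof (cases "k < ?c j")
      case True
      then have "B = real p * real p ^ (?c j - Suc k)"
        by (simp add: B_def power_Suc[symmetric] Suc_diff_Suc del: power_Suc)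
      then show ?thesis
        using le p1 by (intro exI[of _ "\<phi>1 (x ^ p) / of_nat p"]) (simp add: padic_abs_divide_p[OF p_prime])
    next
      case False
      then show ?thesis using le B1 by (intro exI[of _ 0]) (simp add: padic_abs_minus[OF p_prime])
    qed
  qed
  obtain F where F: "finite F" "F \<subseteq> U i" "\<And>x. x \<in> U i \<Longrightarrow> \<exists>y\<in>F. x / y \<in> H"
    using U_finite_index[OF i] unfolding H_def by blast
  have "\<exists>l\<in>L. y / l \<in> H" if "y \<in> F" for y
    using U_iterated_power_surjective[OF j1, of y k] that F(2) ijk by (auto simp: L_def H_def)
  then obtain l where l: "\<And>y. y \<in> F \<Longrightarrow> l y \<in> L" "\<And>y. y \<in> F \<Longrightarrow> y / l y \<in> H" by metis
  have "\<exists>S' \<phi>'. mult_subgroup S' \<and> S1 \<subseteq> S' \<and> l ` F \<subseteq> S' \<and> char_mod p \<phi>' S' \<and>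
    (\<forall>y\<in>S1. padic_abs p (\<phi>' y - \<phi>1 y) \<le> 1) \<and> (\<forall>y\<in>S' \<inter> L. padic_abs p (\<phi>' y) \<le> B)"
    using F(1) l(1) pow S1(3) bound1 root
    by (intro char_mod_adjoin_finite[OF p_prime L B1 _ _ S1(2,1)]) auto
  then obtain \<phi>' S' where S': "mult_subgroup S'" "S1 \<subseteq> S'" "l ` F \<subseteq> S'" "char_mod p \<phi>' S'"
      and close2: "\<And>y. y \<in> S1 \<Longrightarrow> padic_abs p (\<phi>' y - \<phi>1 y) \<le> 1"
      and bound2: "\<And>y. y \<in> S' \<Longrightarrow> y \<in> L \<Longrightarrow> padic_abs p (\<phi>' y) \<le> B"
    by (metis IntI)
  have HS': "H \<subseteq> S'" using S1(3) S'(2) by blast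
  have US': "U i \<subseteq> S'"
  proof
    fix x assume x: "x \<in> U i"
    obtain y where y: "y \<in> F" "x / y \<in> H" using F(3)[OF x] by blast
    have nz: "y \<noteq> 0" "l y \<noteq> 0"
      using U_nonzero[OF i] y(1) F(2) l(1)[OF y(1)] L by (auto simp: mult_subgroup_def)
    have "x / y * (y / l y) * l y \<in> S'"
      using y l(2)[OF y(1)] HS' S'(1,3) unfolding mult_subgroup_def by blast
    then show "x \<in> S'" using nz by simp
  qed
  have close: "padic_abs p (\<phi>' y - \<phi> y) \<le> 1" if y: "y \<in> H" for y
    using padic_abs_le_add[OF p_prime close2[of y] close1[OF y]] y S1(3) by auto
  have char': "char_mod p \<phi>' (U i)" using S'(4) US' unfolding char_mod_def by blast
  have le': "padic_abs p (\<phi>' (y ^ (p ^ n))) \<le> real p ^ (?c j' - n)"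
    if j': "1 \<le> j'" "i \<le> (\<rho> ^^ n) j'" "y \<in> U j'" for j' n y
  proof (cases "Suc i \<le> (\<rho> ^^ n) j'")
    case True
    have "y ^ (p ^ n) \<in> H"
      unfolding H_def using U_iterated_power[OF j'(1,3), of n] U_antimono[OF _ True] by auto
    then show ?thesis using padic_abs_le_if_close[OF close ad_le[OF j'(1) True j'(3)] p_pow] by blast
  next
    case False
    then have "(\<rho> ^^ n) j' = (\<rho> ^^ k) j" using j'(2) ijk by simp
    then have nk: "n \<le> k" "j' = (\<rho> ^^ (k - n)) j" using iterated_shift_unique[OF j j'(1)] by auto
    obtain x where x: "x \<in> U j" "y / x ^ (p ^ (k - n)) \<in> U (Suc j')"
      using U_iterated_power_surjective[OF j1, of y "k - n"] j'(3) nk(2) by auto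
    define v where "v = y / x ^ (p ^ (k - n))"
    have x0: "x \<noteq> 0" using U_nonzero[OF j1 x(1)] .
    have "y = x ^ (p ^ (k - n)) * v" using x0 by (simp add: v_def)
    then have "y ^ (p ^ n) = x ^ (p ^ (k - n) * p ^ n) * v ^ (p ^ n)" by (simp add: power_mult_distrib power_mult)
    moreover have "p ^ (k - n) * p ^ n = p ^ k" using nk(1) by (simp flip: power_add)
    ultimately have eq: "y ^ (p ^ n) = x ^ (p ^ k) * v ^ (p ^ n)" by simp
    have above': "Suc i \<le> (\<rho> ^^ n) (Suc j')"
      using Suc_iterated_shift_le[of n j'] j'(2) by linarith
    have v: "v \<in> U (Suc j')" using x(2) by (simp add: v_def)
    have vH: "v ^ (p ^ n) \<in> H"
      unfolding H_def using U_iterated_power[OF _ v, of n] U_antimono[OF _ above'] by auto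
    have vU: "v ^ (p ^ n) \<in> U i" using vH U_antimono[OF i, of "Suc i"] by (auto simp: H_def)
    have xU: "x ^ (p ^ k) \<in> U i" using U_iterated_power[OF j1 x(1), of k] ijk by simp
    have "?c j \<le> ?c j' + (k - n)" using count_from_iterated_shift_le[OF A j1, of "k - n"] nk(2) by simp
    then have "B \<le> real p ^ (?c j' - n)" unfolding B_def using nk(1) by (intro p_pow_mono) linarith
    moreover have "padic_abs p (\<phi>' (x ^ (p ^ k))) \<le> B"
      using xU US' x(1) by (intro bound2) (auto simp: L_def)
    ultimately have a: "padic_abs p (\<phi>' (x ^ (p ^ k))) \<le> real p ^ (?c j' - n)" by simp
    have "padic_abs p (\<phi> (v ^ (p ^ n))) \<le> real p ^ (?c (Suc j') - n)" by (rule ad_le[OF _ above' v]) simp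
    also have "\<dots> \<le> real p ^ (?c j' - n)"
      using count_from_antimono[OF A, of j' "Suc j'"] by (intro p_pow_mono) auto
    finally have b: "padic_abs p (\<phi>' (v ^ (p ^ n))) \<le> real p ^ (?c j' - n)"
      by (rule padic_abs_le_if_close[OF close[OF vH] _ p_pow])
    have "padic_abs p (\<phi>' (x ^ (p ^ k) * v ^ (p ^ n)) - \<phi>' (x ^ (p ^ k)) - \<phi>' (v ^ (p ^ n))) \<le> 1"
      using char' xU vU unfolding char_mod_def by blast
    then have "padic_abs p (\<phi>' (y ^ (p ^ n)) - (\<phi>' (x ^ (p ^ k)) + \<phi>' (v ^ (p ^ n)))) \<le> 1"
      unfolding eq by (simp add: diff_diff_eq)
    then show ?thesis by (rule padic_abs_le_if_close[OF _ padic_abs_le_add[OF p_prime a b] p_pow])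
  qed
  have ge': "real p ^ (?c j' - n) \<le> padic_abs p (\<phi>' (g j' ^ (p ^ n)))"
    if j': "j' \<in> A" "j' \<in> T_set \<rho>" "n < ?c j'" "i \<le> (\<rho> ^^ n) j'" for j' n
  proof -
    have j'1: "1 \<le> j'" using j'(2) by (simp add: T_set_def)
    have gt: "1 < real p ^ (?c j' - n)" using p1 j'(3) by simp
    show ?thesis
    proof (cases "Suc i \<le> (\<rho> ^^ n) j'")
      case True
      have "g j' ^ (p ^ n) \<in> H"
        unfolding H_def using U_iterated_power[OF j'1 g(1)[OF j'1], of n] U_antimono[OF _ True] by auto
      from padic_abs_ge_if_close[OF close[OF this] ad_ge[OF j'(1-3) True] gt] show ?thesis .
    next
      case False
      then have "(\<rho> ^^ n) j' = (\<rho> ^^ k) j" using j'(4) ijk by simp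
      then have "n \<le> k" "j' = (\<rho> ^^ (k - n)) j" "k \<le> n" 
        using iterated_shift_unique[OF j j'1] iterated_shift_unique[OF j'(2) j1] by metis+
      then have "n = k" "j' = j" by auto
      then show ?thesis
        using padic_abs_ge_if_close[OF close2[OF ge1(1)] ge1(2)] j'(1,3) gt by (simp add: B_def)
    qed
  qed
  show ?thesis unfolding adapted_def using char' le' ge' by blast
qed

lemma adapted_exists:
  assumes A: "A \<in> Jump \<rho>"
    and g: "\<And>j. 1 \<le> j \<Longrightarrow> g j \<in> U j" "\<And>j. 1 \<le> j \<Longrightarrow> g j \<notin> U (Suc j)"
  shows "\<exists>\<phi>. adapted A g 1 \<phi>"
proof -
  let ?S = "(\<lambda>(j, n). (\<rho> ^^ n) j) ` (A \<times> {..<card A})"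
  define N where "N = Suc (Max (insert 0 ?S))"
  have fin: "finite (insert 0 ?S)" using Jump_finite[OF A] by simp
  have N: "(\<rho> ^^ n) j < N" if "j \<in> A" "n < count_from A j" for j n
  proof -
    have "(\<rho> ^^ n) j \<in> ?S" using that count_from_le_card[OF A, of j] by force
    then have "(\<rho> ^^ n) j \<le> Max (insert 0 ?S)" using fin by (intro Max_ge) auto
    then show ?thesis by (simp add: N_def)
  qed
  \<comment> \<open>from level \<open>N\<close> on the trivial character will do\<close>
  have "adapted A g N (\<lambda>_. 0)"
    unfolding adapted_def char_mod_def using N by (auto simp: not_le[symmetric])
  then have base: "\<exists>\<phi>. adapted A g N \<phi>" by blast
  have "1 \<le> N" by (simp add: N_def)
  then show ?thesis
  proof (rule inc_induct[where P = "\<lambda>i. \<exists>\<phi>. adapted A g i \<phi>"])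
    show "\<exists>\<phi>. adapted A g N \<phi>" by (rule base)
    show "\<exists>\<phi>. adapted A g i \<phi>" if "1 \<le> i" "\<exists>\<phi>. adapted A g (Suc i) \<phi>" for i
      using adapted_step[OF A that(1) _ g] that(2) by blast
  qed
qed

text \<open>The invariant at level 1 bounds the values on \<open>U i\<close> by \<open>p ^ c i\<close>; along the chains of \<open>A\<close> the
  bound is attained at every element of \<open>A\<close>, hence at every level. So \<open>c = count_from A\<close>, which drops exactly at
  the elements of \<open>A\<close>, gives the value groups.\<close>

theorem Jump_realised:
  assumes A: "A \<in> Jump \<rho>"
  shows "\<exists>\<phi> N. char_mod p \<phi> (U 1) \<and> 1 \<le> N \<and> (\<forall>u\<in>U N. padic_abs p (\<phi> u) \<le> 1) \<and> val_jumps \<phi> = A"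
proof -
  let ?c = "count_from A"
  obtain g where g: "\<And>j. 1 \<le> j \<Longrightarrow> g j \<in> U j" "\<And>j. 1 \<le> j \<Longrightarrow> g j \<notin> U (Suc j)"
    using U_proper by metis
  obtain \<phi> where ad: "adapted A g 1 \<phi>" using adapted_exists[OF A g] by blast
  have char: "char_mod p \<phi> (U 1)" using ad by (simp add: adapted_def)
  have le: "padic_abs p (\<phi> u) \<le> real p ^ ?c i" if "1 \<le> i" "u \<in> U i" for i u
  proof -
    have "padic_abs p (\<phi> (u ^ (p ^ 0))) \<le> real p ^ (?c i - 0)"
      using ad that unfolding adapted_def by (metis funpow_0)
    then show ?thesis by simp
  qed
  have ge: "\<exists>u\<in>U a. real p ^ ?c a \<le> padic_abs p (\<phi> u)" if a: "a \<in> A" for a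
  proof -
    obtain t k where t: "t \<in> A" "t \<in> T_set \<rho>" "a = (\<rho> ^^ k) t" "?c t = ?c a + k"
      using Jump_chain[OF A a] .
    have t1: "1 \<le> t" using t(2) by (simp add: T_set_def)
    have "0 < ?c a" using count_from_Suc[OF A, of a] a by simp
    then have "real p ^ (?c t - k) \<le> padic_abs p (\<phi> (g t ^ (p ^ k)))"
      using ad t iterated_shift_ge_1[OF t1, of k] unfolding adapted_def by (metis less_add_same_cancel2)
    then show ?thesis using U_iterated_power[OF t1 g(1)[OF t1], of k] t(3,4) by auto
  qed
  have p1: "1 < real p" using prime_gt_1_nat[OF p_prime] by simp
  have vals: "vals \<phi> i = {q. padic_abs p q \<le> real p ^ ?c i}" if i: "1 \<le> i" for i
  proof (intro equalityI subsetI)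
    fix q assume "q \<in> vals \<phi> i"
    then obtain u where u: "u \<in> U i" "padic_abs p (q - \<phi> u) \<le> 1" by (auto simp: vals_def)
    have "padic_abs p q \<le> real p ^ ?c i"
      using padic_abs_le_if_close[OF u(2) le[OF i u(1)]] p1 by simp
    then show "q \<in> {q. padic_abs p q \<le> real p ^ ?c i}" by simp
  next
    fix q assume q: "q \<in> {q. padic_abs p q \<le> real p ^ ?c i}"
    show "q \<in> vals \<phi> i"
    proof (cases "?c i = 0")
      case True
      then show ?thesis using q vals_integral[OF char i] by simp
    next
      case False
      \<comment> \<open>the next jump \<open>a\<close> has the same count, and the values at level \<open>a\<close> already suffice\<close>
      define a where "a = Min {a \<in> A. i \<le> a}"
      have fin: "finite {a \<in> A. i \<le> a}" using Jump_finite[OF A] by simp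
      have ne: "{a \<in> A. i \<le> a} \<noteq> {}" using False unfolding count_from_def by (metis card.empty)
      have a: "a \<in> A" "i \<le> a" using Min_in[OF fin ne] by (auto simp: a_def)
      have "{b \<in> A. i \<le> b} = {b \<in> A. a \<le> b}" using a(2) Min_le[OF fin] by (auto simp: a_def)
      then have ca: "?c i = ?c a" by (simp add: count_from_def)
      obtain u where u: "u \<in> U a" "real p ^ ?c a \<le> padic_abs p (\<phi> u)" using ge[OF a(1)] by blast
      have "\<phi> u \<in> vals \<phi> i" using u(1) U_antimono[OF i a(2)] by (intro vals_value) auto
      then show ?thesis using vals_closed_downward[OF char i, of "\<phi> u" q] u(2) q ca by simp
    qed
  qed
  have "val_jumps \<phi> = A"
  proof (intro equalityI subsetI)
    fix i assume "i \<in> val_jumps \<phi>"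
    then have "1 \<le> i" "vals \<phi> i \<noteq> vals \<phi> (Suc i)" by (auto simp: val_jumps_def)
    then have "?c i \<noteq> ?c (Suc i)" using vals[of i] vals[of "Suc i"] by auto
    then show "i \<in> A" using count_from_Suc[OF A, of i] by (simp split: if_splits)
  next
    fix i assume i: "i \<in> A"
    have i1: "1 \<le> i" using Jump_ge_1[OF A i] .
    obtain u where u: "u \<in> U i" "real p ^ ?c i \<le> padic_abs p (\<phi> u)" using ge[OF i] by blast
    have "?c (Suc i) < ?c i" using count_from_Suc[OF A, of i] i by simp
    then have "real p ^ ?c (Suc i) < padic_abs p (\<phi> u)"
      using u(2) power_strict_increasing[of "?c (Suc i)" "?c i" "real p"] p1 by linarith
    then have "\<phi> u \<notin> vals \<phi> (Suc i)" using vals[of "Suc i"] by simp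
    then show "i \<in> val_jumps \<phi>" using vals_value[OF u(1), of \<phi>] i1 by (auto simp: val_jumps_def)
  qed
  moreover have "padic_abs p (\<phi> u) \<le> 1" if u: "u \<in> U (Suc (Max (insert 0 A)))" for u
  proof -
    have "{a \<in> A. Suc (Max (insert 0 A)) \<le> a} = {}"
      using Jump_finite[OF A] Max_ge[of "insert 0 A"] by (force simp: Suc_le_eq not_less)
    then have "?c (Suc (Max (insert 0 A))) = 0" by (simp only: count_from_def card.empty)
    then show ?thesis using le[OF _ u] by simp
  qed
  ultimately show ?thesis using char by (intro exI[of _ \<phi>] exI[of _ "Suc (Max (insert 0 A))"]) auto
qed

end

section \<open>Characters of the unit group\<close>

context local_field
begin

lemma unit_filt_mult_subgroup: "1 \<le> i \<Longrightarrow> mult_subgroup (unit_filt av i)"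
  unfolding mult_subgroup_def
  using unit_filt_one unit_filt_mult unit_filt_inverse unit_filt_av(2) by blast

lemma unit_filt_proper:
  assumes "1 \<le> i"
  shows "\<exists>x\<in>unit_filt av i. x \<notin> unit_filt av (Suc i)"
proof -
  obtain \<pi> where pi: "av \<pi> = unif_abs" by (rule uniformizer)
  have av: "av (1 + \<pi> ^ i - 1) = unif_abs ^ i" by (simp add: av_power pi)
  show ?thesis
    by (intro bexI[of _ "1 + \<pi> ^ i"]; unfold unit_filt_iff av unif_abs_power_le_iff) auto
qed

lemma unit_filt_finite_index:
  assumes i: "1 \<le> i"
  shows "\<exists>F. finite F \<and> F \<subseteq> unit_filt av i \<and> (\<forall>x\<in>unit_filt av i. \<exists>y\<in>F. x / y \<in> unit_filt av (Suc i))"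
proof -
  obtain R where R: "finite R" "\<And>r. r \<in> R \<Longrightarrow> av r \<le> 1" "\<And>x. av x \<le> 1 \<Longrightarrow> \<exists>r\<in>R. av (x - r) < 1"
    by (rule finite_residue_system) blast
  obtain \<pi> where pi: "av \<pi> = unif_abs" by (rule uniformizer)
  define F where "F = (\<lambda>r. 1 + r * \<pi> ^ i) ` R"
  have sub: "F \<subseteq> unit_filt av i"
    using R(2) unif_abs_pos
    by (auto simp: F_def unit_filt_iff av_mult av_power pi mult_left_le_one_le av_nonneg)
  have "\<exists>y\<in>F. x / y \<in> unit_filt av (Suc i)" if x: "x \<in> unit_filt av i" for x
  proof -
    obtain y where y: "y \<in> F" "av (x - y) \<le> unif_abs ^ Suc i"
      using unit_filt_digit[OF _ pi x, of R] R(3) unfolding F_def by blast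
    have "av y = 1" using unit_filt_av(1)[OF _ i] sub y(1) by blast
    then have "x / y \<in> unit_filt av (Suc i)" using y(2) unit_filt_divide_iff[of y x "Suc i"] by blast
    then show ?thesis using y(1) by blast
  qed
  moreover have "finite F" using R(1) by (simp add: F_def)
  ultimately show ?thesis using sub by blast
qed

text \<open>The unit groups form a basis of neighbourhoods of 1, so a homomorphism into a discrete group is
  continuous exactly if it is trivial on one of them.\<close>

lemma character_representative:
  assumes p: "prime p" and \<psi>: "\<psi> \<in> characters av p"
  shows "\<exists>\<phi> N. char_mod p \<phi> (unit_filt av 1) \<and> 1 \<le> N \<and>
    (\<forall>u\<in>unit_filt av N. padic_abs p (\<phi> u) \<le> 1) \<and>
    (\<forall>u\<in>unit_filt av 1. \<psi> u = rat_class p (\<phi> u))"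
proof -
  let ?U = "unit_filt av 1" and ?Q = "Qp_mod_Zp p"
  have hom: "\<psi> u \<in> carrier ?Q" "\<psi> (u * v) = \<psi> u \<otimes>\<^bsub>?Q\<^esub> \<psi> v" if "u \<in> ?U" "v \<in> ?U" for u v
    using \<psi> that by (auto simp: characters_def hom_def unit_group_def)
  define \<phi> where "\<phi> = (\<lambda>u. SOME q. \<psi> u = rat_class p q)"
  have rep: "\<psi> u = rat_class p (\<phi> u)" if "u \<in> ?U" for u
  proof -
    have "\<exists>q. \<psi> u = rat_class p q" using rat_class_surj[OF p hom(1)[OF that that]] by metis
    then show ?thesis unfolding \<phi>_def by (rule someI_ex)
  qed
  have char: "char_mod p \<phi> ?U"
    unfolding char_mod_def
  proof (intro ballI)
    fix x y assume xy: "x \<in> ?U" "y \<in> ?U"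
    have "rat_class p (\<phi> (x * y)) = rat_class p (\<phi> x + \<phi> y)"
      using rep[OF unit_filt_mult[OF xy order_refl]] rep[OF xy(1)] rep[OF xy(2)] hom(2)[OF xy]
        rat_class_add[OF p, of "\<phi> x" "\<phi> y"] by simp
    then show "padic_abs p (\<phi> (x * y) - \<phi> x - \<phi> y) \<le> 1"
      using rat_class_eq_iff[OF p] by (simp add: diff_diff_eq)
  qed
  have one: "\<psi> 1 = \<one>\<^bsub>?Q\<^esub>"
    using rep[OF unit_filt_one] rat_class_eq_one_iff[OF p] char_mod_one[OF char unit_filt_one p] by simp
  have "continuous_map (subtopology (av_topology av) ?U) (discrete_topology (carrier ?Q)) \<psi>"
    using \<psi> by (simp add: characters_def)
  moreover have "openin (discrete_topology (carrier ?Q)) {\<one>\<^bsub>?Q\<^esub>}"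
    using hom(1)[OF unit_filt_one unit_filt_one] one by simp
  ultimately have "openin (subtopology (av_topology av) ?U)
      {x \<in> topspace (subtopology (av_topology av) ?U). \<psi> x \<in> {\<one>\<^bsub>?Q\<^esub>}}"
    unfolding continuous_map_def by blast
  then obtain T where T: "openin (av_topology av) T"
      "{x \<in> topspace (subtopology (av_topology av) ?U). \<psi> x \<in> {\<one>\<^bsub>?Q\<^esub>}} = T \<inter> ?U"
    by (auto simp: openin_subtopology)
  have top: "topspace (subtopology (av_topology av) ?U) = ?U"
    by (simp add: av_topology_def Metric_space.topspace_mtopology[OF av_metric])
  have T1: "1 \<in> T" and Tker: "\<And>x. x \<in> T \<Longrightarrow> x \<in> ?U \<Longrightarrow> \<psi> x = \<one>\<^bsub>?Q\<^esub>"
    using T(2) one unit_filt_one[of 1] unfolding top by auto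
  obtain r where r: "r > 0" "\<And>y. av (1 - y) < r \<Longrightarrow> y \<in> T"
    using T(1) T1 unfolding openin_av_iff by blast
  have "(\<lambda>n. unif_abs ^ n) \<longlonglongrightarrow> 0"
    using unif_abs_pos unif_abs_less_1 by (intro LIMSEQ_realpow_zero) auto
  then have "\<forall>\<^sub>F n in sequentially. unif_abs ^ n < r" using r(1) by (intro order_tendstoD(2)) auto
  then obtain n where n: "\<And>m. n \<le> m \<Longrightarrow> unif_abs ^ m < r" unfolding eventually_sequentially by blast
  have "padic_abs p (\<phi> u) \<le> 1" if u: "u \<in> unit_filt av (Suc n)" for u
  proof -
    have "av (1 - u) < r" using u n[of "Suc n"] by (simp add: unit_filt_iff av_diff_commute)
    then have "u \<in> T" by (rule r(2))
    moreover have "u \<in> ?U" using u unit_filt_antimono[of 1 "Suc n"] by auto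
    ultimately have "rat_class p (\<phi> u) = \<one>\<^bsub>?Q\<^esub>" using Tker rep by simp
    then show ?thesis using rat_class_eq_one_iff[OF p] by simp
  qed
  then show ?thesis using char rep by (intro exI[of _ \<phi>] exI[of _ "Suc n"]) auto
qed

lemma characterI:
  assumes p: "prime p" and char: "char_mod p \<phi> (unit_filt av 1)" and N: "1 \<le> N"
    and trivial: "\<And>u. u \<in> unit_filt av N \<Longrightarrow> padic_abs p (\<phi> u) \<le> 1"
  shows "(\<lambda>u. rat_class p (\<phi> u)) \<in> characters av p"
proof -
  let ?U = "unit_filt av 1" and ?Q = "Qp_mod_Zp p" and ?\<psi> = "\<lambda>u. rat_class p (\<phi> u)"
  have mult: "?\<psi> (x * y) = rat_class p (\<phi> x + \<phi> y)" if "x \<in> ?U" "y \<in> ?U" for x y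
    using char that unfolding char_mod_def rat_class_eq_iff[OF p] by (simp add: diff_diff_eq)
  have top: "topspace (subtopology (av_topology av) ?U) = ?U"
    by (simp add: av_topology_def Metric_space.topspace_mtopology[OF av_metric])
  have "openin (subtopology (av_topology av) ?U) {x \<in> ?U. ?\<psi> x \<in> V}" for V
  proof -
    have "openin (av_topology av) {x \<in> ?U. ?\<psi> x \<in> V}"
      unfolding openin_av_iff
    proof
      fix x assume x: "x \<in> {x \<in> ?U. ?\<psi> x \<in> V}"
      have avx: "av x = 1" "x \<noteq> 0" using x unit_filt_av[of x 1] by auto
      have "y \<in> {x \<in> ?U. ?\<psi> x \<in> V}" if y: "av (x - y) < unif_abs ^ N" for y
      proof -
        have v: "y / x \<in> unit_filt av N"
          using y unit_filt_divide_iff[OF avx(1)] by (simp add: av_diff_commute)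
        then have v1: "y / x \<in> ?U" using unit_filt_antimono[OF N] by auto
        have xU: "x \<in> ?U" using x by simp
        have eq: "x * (y / x) = y" using avx by simp
        have "?\<psi> y = rat_class p (\<phi> x + \<phi> (y / x))" using mult[OF xU v1] unfolding eq .
        also have "\<dots> = ?\<psi> x" using trivial[OF v] by (simp add: rat_class_eq_iff[OF p])
        finally have "?\<psi> y = ?\<psi> x" .
        moreover have "y \<in> ?U" using unit_filt_mult[OF xU v1 order_refl] unfolding eq .
        ultimately show ?thesis using x by simp
      qed
      then show "\<exists>r>0. \<forall>y. av (x - y) < r \<longrightarrow> y \<in> {x \<in> ?U. ?\<psi> x \<in> V}"
        using unif_abs_pos by (intro exI[of _ "unif_abs ^ N"]) auto
    qed
    then have "openin (subtopology (av_topology av) ?U) (?U \<inter> {x \<in> ?U. ?\<psi> x \<in> V})"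
      by (rule openin_subtopology_Int2)
    moreover have "?U \<inter> {x \<in> ?U. ?\<psi> x \<in> V} = {x \<in> ?U. ?\<psi> x \<in> V}" by auto
    ultimately show ?thesis by simp
  qed
  then have "continuous_map (subtopology (av_topology av) ?U) (discrete_topology (carrier ?Q)) ?\<psi>"
    unfolding continuous_map_def top using rat_class_closed[OF p] by auto
  moreover have "?\<psi> \<in> hom (unit_group av 1) ?Q"
    using mult rat_class_add[OF p] rat_class_closed[OF p] by (auto simp: hom_def unit_group_def)
  ultimately show ?thesis by (simp add: characters_def)
qed

end

context local_field_no_p_torsion
begin

sublocale units: shifted_filtration "unit_filt av" p shift
proof
  fix i v assume "1 \<le> i" "v \<in> unit_filt av (shift i)"
  then show "\<exists>u\<in>unit_filt av i. v / u ^ p \<in> unit_filt av (Suc (shift i))"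
    using unit_filt_power_surjective by metis
qed (use p_prime unit_filt_mult_subgroup unit_filt_antimono unit_filt_proper unit_filt_finite_index
    shift_strict_mono shift_gt unit_filt_power unit_filt_power_injective in auto)

lemma jumps_eq_val_jumps:
  assumes rep: "\<And>u. u \<in> unit_filt av 1 \<Longrightarrow> \<psi> u = rat_class p (\<phi> u)"
  shows "jumps av \<psi> = units.val_jumps \<phi>"
proof -
  have image: "\<psi> ` unit_filt av i = rat_class p ` units.vals \<phi> i" if i: "1 \<le> i" for i
  proof (intro equalityI subsetI)
    fix X assume "X \<in> \<psi> ` unit_filt av i"
    then obtain u where u: "u \<in> unit_filt av i" "X = \<psi> u" by blast
    then have "X = rat_class p (\<phi> u)" using rep unit_filt_antimono[OF i] by blast
    then show "X \<in> rat_class p ` units.vals \<phi> i" using units.vals_value[OF u(1)] by blast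
  next
    fix X assume "X \<in> rat_class p ` units.vals \<phi> i"
    then obtain q u where u: "u \<in> unit_filt av i" "X = rat_class p q" "padic_abs p (q - \<phi> u) \<le> 1"
      by (auto simp: units.vals_def)
    then have "X = rat_class p (\<phi> u)" using rat_class_eq_iff[OF p_prime] by simp
    then have "X = \<psi> u" using rep u(1) unit_filt_antimono[OF i] by auto
    then show "X \<in> \<psi> ` unit_filt av i" using u(1) by blast
  qed
  have preimage: "q \<in> units.vals \<phi> i \<longleftrightarrow> rat_class p q \<in> rat_class p ` units.vals \<phi> i" for q i
  proof
    assume "rat_class p q \<in> rat_class p ` units.vals \<phi> i"
    then obtain r u where r: "padic_abs p (q - r) \<le> 1" "u \<in> unit_filt av i" "padic_abs p (r - \<phi> u) \<le> 1"
      using rat_class_eq_iff[OF p_prime] by (auto simp: units.vals_def)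
    then show "q \<in> units.vals \<phi> i"
      using padic_abs_le_add[OF p_prime r(1) r(3)] by (auto simp: units.vals_def)
  qed blast
  have "units.vals \<phi> i = units.vals \<phi> (Suc i)"
    if "rat_class p ` units.vals \<phi> i = rat_class p ` units.vals \<phi> (Suc i)" for i
  proof -
    have "q \<in> units.vals \<phi> i \<longleftrightarrow> q \<in> units.vals \<phi> (Suc i)" for q
      unfolding preimage[of q i] preimage[of q "Suc i"] that ..
    then show ?thesis by blast
  qed
  then have "\<psi> ` unit_filt av i = \<psi> ` unit_filt av (Suc i) \<longleftrightarrow> units.vals \<phi> i = units.vals \<phi> (Suc i)"
    if "1 \<le> i" for i using image[OF that] image[of "Suc i"] by auto
  then show ?thesis by (auto simp: jumps_def units.val_jumps_def)
qed

end

theorem theorem1p16: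
  fixes av :: "'a::field \<Rightarrow> real" and p :: nat
  assumes "local_field av"
    and "has_residue_char av p"
    and "mu p = {1 :: 'a}"
  shows "jump_sets av p = Jump (rho (ram_index av p) p)"
proof -
  interpret local_field av by fact
  interpret K: local_field_no_p_torsion av p by unfold_locales fact+
  have "jump_sets av p = Jump K.shift"
  proof (intro equalityI subsetI)
    fix A assume "A \<in> jump_sets av p"
    then obtain \<psi> where psi: "\<psi> \<in> characters av p" "A = jumps av \<psi>" by (auto simp: jump_sets_def)
    obtain \<phi> N where phi: "char_mod p \<phi> (unit_filt av 1)" "1 \<le> N"
      "\<And>u. u \<in> unit_filt av N \<Longrightarrow> padic_abs p (\<phi> u) \<le> 1"
      "\<And>u. u \<in> unit_filt av 1 \<Longrightarrow> \<psi> u = rat_class p (\<phi> u)"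
      using character_representative[OF K.p_prime psi(1)] by metis
    have "A = K.units.val_jumps \<phi>" using K.jumps_eq_val_jumps[of \<psi> \<phi>] phi(4) psi(2) by simp
    then show "A \<in> Jump K.shift" using K.units.val_jumps_in_Jump[OF phi(1,2)] phi(3) by simp
  next
    fix A assume "A \<in> Jump K.shift"
    then obtain \<phi> N where phi: "char_mod p \<phi> (unit_filt av 1)" "1 \<le> N"
        "\<And>u. u \<in> unit_filt av N \<Longrightarrow> padic_abs p (\<phi> u) \<le> 1" "K.units.val_jumps \<phi> = A"
      using K.units.Jump_realised by metis
    have "jumps av (\<lambda>u. rat_class p (\<phi> u)) = A"
      using K.jumps_eq_val_jumps[of "\<lambda>u. rat_class p (\<phi> u)" \<phi>] phi(4) by simp
    then show "A \<in> jump_sets av p"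
      using characterI[OF K.p_prime phi(1,2)] phi(3) unfolding jump_sets_def by blast
  qed
  then show ?thesis by (simp add: K.shift_def)
qed

end
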